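(* Let $H$ be an infinite-dimensional complex separable Hilbert space, let $T\in\mathcal B(H)$ and $1\le p<\infty$. Assume that $T=\sqrt{\alpha}\,V+K$, where $K\in\mathcal K_p(H)$, $\alpha>0$, and $V\in\mathcal B(H)$ is a partial isometry with $\dim N(V)<\infty$. Then $T$ has closed range and $$T^\dagger=\frac{1}{\sqrt{\alpha}}\,V^*+L$$ for some $L\in\mathcal K_p(H)$. In particular, $T^\dagger-\frac{1}{\sqrt{\alpha}}V^*\in\mathcal K_p(H)$.
   Context: $\mathcal B(H)$ denotes the bounded linear operators on $H$; $N(V)$ is the null space of $V$. $\mathcal K_p(H)$ is the Schatten $p$-class: compact operators $A$ whose singular values $s_n(A)$ (eigenvalues of $(A^*A)^{1/2}$ with multiplicity) satisfy $\sum_n s_n(A)^p<\infty$. If $T$ has closed range, the Moore--Penrose inverse $T^\dagger\in\mathcal B(H)$ is the unique operator such that $TT^\dagger$ and $T^\dagger T$ are self-adjoint, $TT^\dagger T=T$ and $T^\dagger TT^\dagger=T^\dagger$. *)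

theory Defs
  imports "HOL-Analysis.Analysis"
begin

text \<open>Complex inner product spaces over the real ones of the library: the real inner product is
  the real part of the complex one, so the norm, the metric and the topology of
  \<^class>\<open>real_inner\<close> are those of the complex space. The form is linear in its first argument.
  Positivity and definiteness follow from those of the real inner product.\<close>

class complex_inner_space = real_inner +
  fixes scaleC :: "complex \<Rightarrow> 'a \<Rightarrow> 'a" (infixr "*\<^sub>C" 75)
    and cinner :: "'a \<Rightarrow> 'a \<Rightarrow> complex"
  assumes scaleC_add_right: "c *\<^sub>C (x + y) = c *\<^sub>C x + c *\<^sub>C y"
    and scaleC_add_left: "(c + d) *\<^sub>C x = c *\<^sub>C x + d *\<^sub>C x"
    and scaleC_scaleC: "c *\<^sub>C d *\<^sub>C x = (c * d) *\<^sub>C x"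
    and scaleR_scaleC: "scaleR r x = complex_of_real r *\<^sub>C x"
    and cinner_commute: "cinner x y = cnj (cinner y x)"
    and cinner_add_left: "cinner (x + y) z = cinner x z + cinner y z"
    and cinner_scaleC_left: "cinner (c *\<^sub>C x) y = c * cinner x y"
    and inner_eq_Re_cinner: "inner x y = Re (cinner x y)"

class complex_hilbert_space = complex_inner_space + complete_space

global_interpretation complex_vector:
  vector_space "scaleC :: complex \<Rightarrow> 'a \<Rightarrow> 'a::complex_inner_space"
  defines cspan = complex_vector.span
    and cdim = complex_vector.dim
proof
  fix x :: 'a
  show "1 *\<^sub>C x = x"
    using scaleR_scaleC[of 1 x] by simp
qed (simp_all add: scaleC_add_right scaleC_add_left scaleC_scaleC)

definition finite_dimensional :: "'a::complex_inner_space set \<Rightarrow> bool" where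
  "finite_dimensional S \<longleftrightarrow> (\<exists>B. finite B \<and> cspan B = S)"

definition bounded_clinear :: "('a::complex_inner_space \<Rightarrow> 'a) \<Rightarrow> bool" where
  "bounded_clinear A \<longleftrightarrow> bounded_linear A \<and> (\<forall>c x. A (c *\<^sub>C x) = c *\<^sub>C A x)"

definition null_space :: "('a::complex_inner_space \<Rightarrow> 'a) \<Rightarrow> 'a set" where
  "null_space A = {x. A x = 0}"

definition cadjoint :: "('a::complex_inner_space \<Rightarrow> 'a) \<Rightarrow> 'a \<Rightarrow> 'a" where
  "cadjoint A = (SOME B. \<forall>x y. cinner (A x) y = cinner x (B y))"

definition self_adjoint :: "('a::complex_inner_space \<Rightarrow> 'a) \<Rightarrow> bool" where
  "self_adjoint A \<longleftrightarrow> cadjoint A = A"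

definition partial_isometry :: "('a::complex_inner_space \<Rightarrow> 'a) \<Rightarrow> bool" where
  "partial_isometry V \<longleftrightarrow> bounded_clinear V \<and>
     (\<forall>x. (\<forall>y\<in>null_space V. cinner x y = 0) \<longrightarrow> norm (V x) = norm x)"

definition positive_operator :: "('a::complex_inner_space \<Rightarrow> 'a) \<Rightarrow> bool" where
  "positive_operator P \<longleftrightarrow> bounded_clinear P \<and> self_adjoint P \<and>
     (\<forall>x. cinner (P x) x \<in> \<real> \<and> Re (cinner (P x) x) \<ge> 0)"

text \<open>The positive square root of \<open>A\<^sup>*A\<close>, which exists and is unique for every bounded operator
  on a Hilbert space.\<close>

definition abs_operator :: "('a::complex_inner_space \<Rightarrow> 'a) \<Rightarrow> 'a \<Rightarrow> 'a" where
  "abs_operator A = (SOME P. positive_operator P \<and> P \<circ> P = cadjoint A \<circ> A)"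

definition compact_operator :: "('a::complex_inner_space \<Rightarrow> 'a) \<Rightarrow> bool" where
  "compact_operator A \<longleftrightarrow> bounded_clinear A \<and> compact (closure (A ` cball 0 1))"

definition eigenspace :: "('a::complex_inner_space \<Rightarrow> 'a) \<Rightarrow> complex \<Rightarrow> 'a set" where
  "eigenspace A \<mu> = {x. A x = \<mu> *\<^sub>C x}"

text \<open>\<open>singular_values A\<close> is the decreasing enumeration of the eigenvalues of \<open>(A\<^sup>*A)\<^sup>1\<^sup>/\<^sup>2\<close>: every
  \<open>r > 0\<close> occurs as often as the dimension of its eigenspace says (so not at all if \<open>r\<close> is not
  an eigenvalue). Only zeros can occur besides; they pad the sequence if there are finitely many
  positive eigenvalues. For compact \<open>A\<close> such a sequence exists and is unique, the eigenspaces of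
  positive eigenvalues being finite-dimensional; only then is it meaningful.\<close>

definition singular_values :: "('a::complex_inner_space \<Rightarrow> 'a) \<Rightarrow> nat \<Rightarrow> real" where
  "singular_values A = (SOME s. decseq s \<and> (\<forall>n. s n \<ge> 0) \<and>
     (\<forall>r>0. finite {n. s n = r} \<and>
        card {n. s n = r} = cdim (eigenspace (abs_operator A) (complex_of_real r))))"

definition schatten_class :: "real \<Rightarrow> ('a::complex_inner_space \<Rightarrow> 'a) set" where
  "schatten_class p =
     {A. compact_operator A \<and> summable (\<lambda>n. singular_values A n powr p)}"

text \<open>Uniqueness holds for every operator; existence requires closed range.\<close>

definition moore_penrose :: "('a::complex_inner_space \<Rightarrow> 'a) \<Rightarrow> 'a \<Rightarrow> 'a" where
  "moore_penrose T = (THE X. bounded_clinear X \<and>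
     self_adjoint (T \<circ> X) \<and> self_adjoint (X \<circ> T) \<and>
     T \<circ> X \<circ> T = T \<and> X \<circ> T \<circ> X = X)"

end

theory Submission
  imports Defs
begin

text \<open>Let \<open>W = V\<^sup>* / \<surd>\<alpha>\<close>. Since \<open>V\<^sup>*V = I - P\<close> with \<open>P\<close> the orthogonal projection onto the
  finite-dimensional null space of \<open>V\<close>, the operator \<open>W\<close> is a left inverse of \<open>T\<close> up to
  an element of the Schatten class: \<open>W T = I + C\<close> with \<open>C = W K - P\<close>. As \<open>C\<close> is compact, \<open>T\<close> is
  bounded below on the orthogonal complement of its null space
  (\<open>bounded_below_of_left_inverse_modulo_compact\<close>); hence its range is closed and \<open>S = T\<^sup>\<dagger>\<close> exists.

  To compare \<open>S\<close> with \<open>W\<close>, apply \<open>W T = I + C\<close> to \<open>S y\<close> and put \<open>z = y - T S y\<close>. This gives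
  \<open>S y - W y = - W z - C S y\<close>. As \<open>T S\<close> is the orthogonal projection onto the range of \<open>T\<close>, the vector
  \<open>z\<close> is orthogonal to that range, so \<open>0 = T\<^sup>* z = \<surd>\<alpha> V\<^sup>* z + K\<^sup>* z\<close> and \<open>W z = - K\<^sup>* z / \<alpha>\<close>. Therefore
  \<open>S - W = K\<^sup>* (I - T S) / \<alpha> - C S\<close>, which is in the Schatten class, because that class is a two-sided
  ideal, closed under adjoints, and contains the projections onto finite-dimensional subspaces.

  The ideal properties are not visible from singular values defined by multiplicities of
  eigenvalues. They follow from the minimax principle, by which the \<open>n\<close>-th singular value of a compact
  operator \<open>A\<close> is the least \<open>\<epsilon>\<close> such that \<open>\<parallel>A x\<parallel> \<le> \<epsilon> \<parallel>x\<parallel>\<close> whenever \<open>x\<close> is orthogonal to some fixed \<open>n\<close>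
  vectors (the Gelfand number): for such bounds, sums, products and adjoints are easy
  (\<open>schatten_class_iff_gelfand_bound\<close>). The principle rests on the spectral decomposition of
  \<open>A\<^sup>*A\<close>, obtained by maximizing \<open>\<parallel>A x\<parallel>\<close> on the complement of the eigenvectors already found
  (\<open>next_singular_vector\<close>), which also yields the square root of \<open>A\<^sup>*A\<close> and the multiplicities of its
  eigenvalues.\<close>

section \<open>Complex inner product spaces\<close>

lemma cinner_zero_left [simp]: "cinner 0 y = 0"
  using cinner_add_left[of 0 0 y] by simp

lemma cinner_add_right: "cinner x (y + z) = cinner x y + cinner x z"
  by (metis cinner_add_left cinner_commute complex_cnj_add)

lemma cinner_zero_right [simp]: "cinner x 0 = 0"
  using cinner_add_right[of x 0 0] by simp

lemma cinner_scaleC_right: "cinner x (c *\<^sub>C y) = cnj c * cinner x y"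
  by (metis cinner_commute cinner_scaleC_left complex_cnj_mult)

lemma cinner_diff_left: "cinner (x - y) z = cinner x z - cinner y z"
  by (metis cinner_add_left add_diff_cancel_right' diff_add_cancel)

lemma cinner_diff_right: "cinner x (y - z) = cinner x y - cinner x z"
  by (metis cinner_add_right add_diff_cancel_right' diff_add_cancel)

lemma cinner_sum_left: "cinner (\<Sum>i\<in>J. f i) y = (\<Sum>i\<in>J. cinner (f i) y)"
  by (induction J rule: infinite_finite_induct) (auto simp: cinner_add_left)

lemma cinner_eq_zero_commute: "cinner x y = 0 \<longleftrightarrow> cinner y x = 0"
  by (metis cinner_commute complex_cnj_zero)

lemma cinner_self: "cinner x x = complex_of_real ((norm x)\<^sup>2)"
proof -
  have "Im (cinner x x) = - Im (cinner x x)"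
    using arg_cong[OF cinner_commute[of x x], of Im] by simp
  then show ?thesis
    by (simp add: complex_eq_iff inner_eq_Re_cinner[symmetric] power2_norm_eq_inner)
qed

lemma cinner_eq_all_imp_eq: "(\<And>z. cinner x z = cinner y z) \<Longrightarrow> x = y"
proof -
  assume "\<And>z. cinner x z = cinner y z"
  then have "cinner (x - y) (x - y) = 0" by (simp add: cinner_diff_left)
  then show ?thesis by (simp add: cinner_self)
qed

lemma cinner_eq_all_imp_eq_right: "(\<And>z. cinner z x = cinner z y) \<Longrightarrow> x = y"
  by (metis cinner_commute cinner_eq_all_imp_eq)

lemma norm_scaleC: "norm (c *\<^sub>C x) = norm c * norm x"
proof -
  have "complex_of_real ((norm (c *\<^sub>C x))\<^sup>2) = c * cnj c * cinner x x"
    by (simp only: cinner_self[symmetric] cinner_scaleC_left cinner_scaleC_right mult_ac)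
  also have "\<dots> = complex_of_real ((norm c * norm x)\<^sup>2)"
    by (simp only: complex_norm_square[symmetric] cinner_self power_mult_distrib of_real_mult of_real_power)
  finally have "(norm (c *\<^sub>C x))\<^sup>2 = (norm c * norm x)\<^sup>2"
    using of_real_eq_iff by blast
  then show ?thesis by (simp add: power2_eq_iff_nonneg)
qed

lemma norm_cinner_le: "norm (cinner x y) \<le> norm x * norm y"
proof -
  define c where "c = cnj (sgn (cinner x y))"
  have "c * cinner x y = complex_of_real (norm (cinner x y))"
    using complex_norm_square[of "cinner x y", symmetric]
    by (cases "cinner x y = 0") (simp_all add: c_def sgn_eq power2_eq_square mult_ac)
  then have "norm (cinner x y) = inner (c *\<^sub>C x) y"
    by (simp add: inner_eq_Re_cinner cinner_scaleC_left)
  also have "\<dots> \<le> norm (c *\<^sub>C x) * norm y" by (rule norm_cauchy_schwarz)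
  also have "\<dots> \<le> norm x * norm y"
    by (intro mult_right_mono) (auto simp: norm_scaleC c_def norm_sgn)
  finally show ?thesis .
qed

lemma bounded_bilinear_cinner: "bounded_bilinear (cinner :: 'a::complex_inner_space \<Rightarrow> _)"
proof
  show "\<exists>K. \<forall>a b. norm (cinner (a::'a) b) \<le> norm a * norm b * K"
    by (intro exI[of _ 1]) (simp add: norm_cinner_le)
qed (simp_all add: cinner_add_left cinner_add_right scaleR_scaleC cinner_scaleC_left
    cinner_scaleC_right scaleR_conv_of_real)

lemma bounded_bilinear_scaleC: "bounded_bilinear (scaleC :: complex \<Rightarrow> 'a \<Rightarrow> 'a::complex_inner_space)"
proof
  show "\<exists>K. \<forall>a b. norm (a *\<^sub>C (b::'a)) \<le> norm a * norm b * K"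
    by (intro exI[of _ 1]) (simp add: norm_scaleC)
qed (simp_all add: scaleC_add_left scaleC_add_right scaleR_scaleC scaleC_scaleC
    scaleR_conv_of_real mult.commute)

lemmas tendsto_cinner = bounded_bilinear.tendsto[OF bounded_bilinear_cinner]
lemmas tendsto_scaleC = bounded_bilinear.tendsto[OF bounded_bilinear_scaleC]

lemma norm_add_orthogonal:
  assumes "cinner x y = 0"
  shows "(norm (x + y))\<^sup>2 = (norm x)\<^sup>2 + (norm y)\<^sup>2"
  using assms by (simp add: power2_norm_eq_inner inner_add_left inner_add_right inner_commute
      inner_eq_Re_cinner[of x y])

lemma norm_diff_square:
  "(norm (x - y))\<^sup>2 = (norm x)\<^sup>2 - 2 * Re (cinner x y) + (norm (y::'a::complex_inner_space))\<^sup>2"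
  by (simp add: power2_norm_eq_inner inner_diff_left inner_diff_right inner_commute
      inner_eq_Re_cinner[of x y, symmetric])

section \<open>Bounded complex-linear operators\<close>

lemma bounded_clinear_imp_bounded_linear: "bounded_clinear A \<Longrightarrow> bounded_linear A"
  by (simp add: bounded_clinear_def)

lemma bounded_clinearI:
  assumes "\<And>x y. A (x + y) = A x + A y" and "\<And>c x. A (c *\<^sub>C x) = c *\<^sub>C A x"
    and "\<And>x. norm (A x) \<le> M * norm x"
  shows "bounded_clinear A"
  unfolding bounded_clinear_def
  by (intro conjI bounded_linear_intro[where K = M])
    (use assms in \<open>simp_all add: scaleR_scaleC mult.commute\<close>)

context
  fixes A :: "'a::complex_inner_space \<Rightarrow> 'a"
  assumes A: "bounded_clinear A"
begin

lemma bounded_clinear_add: "A (x + y) = A x + A y"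
  using A by (simp add: bounded_clinear_def linear_simps)

lemma bounded_clinear_diff: "A (x - y) = A x - A y"
  using A by (simp add: bounded_clinear_def linear_simps)

lemma bounded_clinear_zero: "A 0 = 0"
  using bounded_clinear_diff[of 0 0] by simp

lemma bounded_clinear_scaleC: "A (c *\<^sub>C x) = c *\<^sub>C A x"
  using A by (simp add: bounded_clinear_def)

lemma bounded_clinear_sum: "A (\<Sum>i\<in>J. f i) = (\<Sum>i\<in>J. A (f i))"
  by (induction J rule: infinite_finite_induct)
    (auto simp: bounded_clinear_add bounded_clinear_zero)

lemma bounded_clinear_bound: obtains M where "M > 0" "\<And>x. norm (A x) \<le> M * norm x"
  using bounded_linear.pos_bounded[OF bounded_clinear_imp_bounded_linear[OF A]]
  by (metis mult.commute)

lemma bounded_clinear_tendsto: "X \<longlonglongrightarrow> x \<Longrightarrow> (\<lambda>n. A (X n)) \<longlonglongrightarrow> A x"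
  using A by (auto simp: bounded_clinear_def intro: bounded_linear.tendsto)

lemma subspace_null_space: "complex_vector.subspace (null_space A)"
  by (auto simp: complex_vector.subspace_def null_space_def bounded_clinear_zero
      bounded_clinear_add bounded_clinear_scaleC)

lemma closed_null_space: "closed (null_space A)"
proof -
  have "continuous_on UNIV A"
    by (intro linear_continuous_on bounded_clinear_imp_bounded_linear A)
  then have "closed (A -` {0})"
    by (intro closed_vimage) auto
  also have "A -` {0} = null_space A" by (auto simp: null_space_def)
  finally show ?thesis .
qed

end

lemma bounded_clinear_plus:
  "bounded_clinear A \<Longrightarrow> bounded_clinear B \<Longrightarrow> bounded_clinear (\<lambda>x. A x + B x)"
  by (auto simp: bounded_clinear_def scaleC_add_right intro: bounded_linear_add)

lemma bounded_clinear_minus: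
  "bounded_clinear A \<Longrightarrow> bounded_clinear B \<Longrightarrow> bounded_clinear (\<lambda>x. A x - B x)"
  by (auto simp: bounded_clinear_def complex_vector.scale_right_diff_distrib
      intro: bounded_linear_sub)

lemma bounded_clinear_compose:
  "bounded_clinear A \<Longrightarrow> bounded_clinear B \<Longrightarrow> bounded_clinear (\<lambda>x. A (B x))"
  by (auto simp: bounded_clinear_def intro: bounded_linear_compose)

lemma bounded_clinear_ident: "bounded_clinear (\<lambda>x. x)"
  by (auto simp: bounded_clinear_def)

lemma bounded_clinear_scaleC_ident: "bounded_clinear (\<lambda>x. c *\<^sub>C x)"
  by (rule bounded_clinearI[where M = "norm c"])
    (auto simp: scaleC_add_right scaleC_scaleC mult.commute norm_scaleC)

section \<open>Orthogonal projections and adjoints in Hilbert spaces\<close>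

definition orthogonal_complement :: "'a::complex_inner_space set \<Rightarrow> 'a set" where
  "orthogonal_complement S = {x. \<forall>y\<in>S. cinner x y = 0}"

definition orthogonal_projection :: "'a::complex_inner_space set \<Rightarrow> 'a \<Rightarrow> 'a" where
  "orthogonal_projection M x = (SOME m. m \<in> M \<and> x - m \<in> orthogonal_complement M)"

lemma subspace_orthogonal_complement: "complex_vector.subspace (orthogonal_complement S)"
  by (auto simp: complex_vector.subspace_def orthogonal_complement_def cinner_add_left
      cinner_scaleC_left)

lemma orthogonal_complement_limit:
  assumes "\<And>n. X n \<in> orthogonal_complement S" "X \<longlonglongrightarrow> x"
  shows "x \<in> orthogonal_complement S"
proof -
  have "cinner x y = 0" if "y \<in> S" for y
  proof -
    have "(\<lambda>n. cinner (X n) y) \<longlonglongrightarrow> cinner x y"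
      by (intro tendsto_cinner assms tendsto_const)
    moreover have "(\<lambda>n. cinner (X n) y) = (\<lambda>_. 0)"
      using assms(1) that by (auto simp: orthogonal_complement_def)
    ultimately show ?thesis by (simp add: LIMSEQ_const_iff)
  qed
  then show ?thesis by (simp add: orthogonal_complement_def)
qed

text \<open>Otherwise, subtracting from \<open>w\<close> its component along \<open>y\<close> would make it shorter.\<close>

lemma orthogonal_of_minimal_distance:
  assumes min: "\<And>c. norm w \<le> norm (w - c *\<^sub>C y)"
  shows "cinner w y = 0"
proof (rule ccontr)
  define t where "t = cinner w y"
  define c where "c = t / complex_of_real ((norm y)\<^sup>2)"
  assume "cinner w y \<noteq> 0"
  then have y: "norm y \<noteq> 0" and t: "norm t > 0" by (auto simp: t_def)
  have "cinner w (c *\<^sub>C y) = cnj t * t / complex_of_real ((norm y)\<^sup>2)"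
    by (simp add: cinner_scaleC_right c_def t_def)
  also have "\<dots> = complex_of_real ((norm t)\<^sup>2 / (norm y)\<^sup>2)"
    using complex_norm_square[of t] by (simp add: mult.commute)
  finally have 1: "Re (cinner w (c *\<^sub>C y)) = (norm t)\<^sup>2 / (norm y)\<^sup>2" by simp
  have 2: "(norm (c *\<^sub>C y))\<^sup>2 = (norm t)\<^sup>2 / (norm y)\<^sup>2"
    using y by (simp add: norm_scaleC c_def norm_divide power_mult_distrib power_divide
        power2_eq_square norm_mult)
  have "(norm (w - c *\<^sub>C y))\<^sup>2 = (norm w)\<^sup>2 - (norm t)\<^sup>2 / (norm y)\<^sup>2"
    by (simp add: norm_diff_square 1 2)
  also have "\<dots> < (norm w)\<^sup>2" using t y by simp
  finally have "norm (w - c *\<^sub>C y) < norm w"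
    by (rule power_less_imp_less_base) simp
  then show False using min[of c] by simp
qed

text \<open>A minimizing sequence for the distance to \<open>M\<close> is Cauchy by the parallelogram law, and the
  difference to a closest point is orthogonal to \<open>M\<close>.\<close>

lemma orthogonal_decomposition_exists:
  fixes M :: "'a::complex_hilbert_space set"
  assumes closed: "closed M" and sub: "complex_vector.subspace M"
  shows "\<exists>m. m \<in> M \<and> x - m \<in> orthogonal_complement M"
proof -
  define D where "D = Inf ((\<lambda>y. (norm (x - y))\<^sup>2) ` M)"
  have D_le: "D \<le> (norm (x - y))\<^sup>2" if "y \<in> M" for y
    unfolding D_def using that by (intro cINF_lower bdd_belowI2[where m = 0]) auto
  have "\<exists>y\<in>M. (norm (x - y))\<^sup>2 < D + inverse (real (Suc n))" for n
  proof -
    have "(\<lambda>y. (norm (x - y))\<^sup>2) ` M \<noteq> {}"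
      using complex_vector.subspace_0[OF sub] by auto
    then show ?thesis
      using cInf_lessD[of "(\<lambda>y. (norm (x - y))\<^sup>2) ` M" "D + inverse (real (Suc n))"]
      by (auto simp: D_def)
  qed
  then obtain y where y: "\<And>n. y n \<in> M"
    and y_less: "\<And>n. (norm (x - y n))\<^sup>2 < D + inverse (real (Suc n))"
    by metis
  have dist_y: "(norm (y m - y n))\<^sup>2 \<le> 2 * inverse (real (Suc m)) + 2 * inverse (real (Suc n))" for m n
  proof -
    define h where "h = complex_of_real (1/2) *\<^sub>C (y m + y n)"
    have "h \<in> M"
      unfolding h_def using y sub by (intro complex_vector.subspace_scale complex_vector.subspace_add)
    moreover have "h = (1/2) *\<^sub>R (y m + y n)" by (simp add: h_def scaleR_scaleC)
    moreover have "(norm (y m - y n))\<^sup>2 + 4 * (norm (x - (1/2) *\<^sub>R (y m + y n)))\<^sup>2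
      = 2 * (norm (x - y m))\<^sup>2 + 2 * (norm (x - y n))\<^sup>2"
      by (simp add: power2_norm_eq_inner inner_diff_left inner_diff_right inner_add_left
          inner_add_right inner_commute algebra_simps)
    ultimately show ?thesis using D_le[of h] y_less[of m] y_less[of n] by simp
  qed
  have "Cauchy y"
  proof (rule CauchyI)
    fix e :: real assume "e > 0"
    then obtain N where N: "inverse (real (Suc N)) < e\<^sup>2 / 4"
      using reals_Archimedean[of "e\<^sup>2 / 4"] by auto
    have "norm (y m - y n) < e" if "m \<ge> N" "n \<ge> N" for m n
    proof -
      have "inverse (real (Suc m)) \<le> inverse (real (Suc N))"
        "inverse (real (Suc n)) \<le> inverse (real (Suc N))"
        using that by (auto intro!: le_imp_inverse_le)
      then have "(norm (y m - y n))\<^sup>2 < e\<^sup>2" using dist_y[of m n] N by linarith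
      then show ?thesis using \<open>e > 0\<close> by (simp add: power_less_imp_less_base)
    qed
    then show "\<exists>N. \<forall>m\<ge>N. \<forall>n\<ge>N. norm (y m - y n) < e" by blast
  qed
  then obtain m where m: "y \<longlonglongrightarrow> m" using Cauchy_convergent convergent_def by blast
  then have "m \<in> M" using closed y closed_sequentially by blast
  have "(\<lambda>n. (norm (x - y n))\<^sup>2) \<longlonglongrightarrow> (norm (x - m))\<^sup>2"
    by (intro tendsto_intros m)
  moreover have "(\<lambda>n. D + inverse (real (Suc n))) \<longlonglongrightarrow> D + 0"
    by (intro tendsto_intros LIMSEQ_inverse_real_of_nat)
  ultimately have le_D: "(norm (x - m))\<^sup>2 \<le> D + 0"
    by (rule LIMSEQ_le) (use y_less less_imp_le in blast)
  have "cinner (x - m) z = 0" if "z \<in> M" for z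
  proof (rule orthogonal_of_minimal_distance)
    fix c
    have "m + c *\<^sub>C z \<in> M"
      using that \<open>m \<in> M\<close> sub by (intro complex_vector.subspace_scale complex_vector.subspace_add)
    from D_le[OF this] le_D have "(norm (x - m))\<^sup>2 \<le> (norm (x - m - c *\<^sub>C z))\<^sup>2"
      unfolding diff_diff_add by linarith
    then show "norm (x - m) \<le> norm (x - m - c *\<^sub>C z)" by (rule power2_le_imp_le) simp
  qed
  with \<open>m \<in> M\<close> show ?thesis by (auto simp: orthogonal_complement_def)
qed

context
  fixes M :: "'a::complex_hilbert_space set"
  assumes closed: "closed M" and sub: "complex_vector.subspace M"
begin

lemma orthogonal_projection_in: "orthogonal_projection M x \<in> M"
  and orthogonal_projection_diff: "x - orthogonal_projection M x \<in> orthogonal_complement M"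
  using someI_ex[OF orthogonal_decomposition_exists[OF closed sub, of x]]
  by (auto simp: orthogonal_projection_def)

lemma orthogonal_projection_unique:
  assumes "m \<in> M" "x - m \<in> orthogonal_complement M"
  shows "orthogonal_projection M x = m"
proof -
  let ?m = "orthogonal_projection M x"
  have "m - ?m \<in> M"
    using assms(1) orthogonal_projection_in sub by (intro complex_vector.subspace_diff)
  then have "cinner (x - ?m) (m - ?m) = 0" "cinner (x - m) (m - ?m) = 0"
    using assms(2) orthogonal_projection_diff by (auto simp: orthogonal_complement_def)
  then have "cinner (m - ?m) (m - ?m) = 0"
    by (simp add: cinner_diff_left)
  then show ?thesis by (simp add: cinner_self)
qed

lemma orthogonal_projection_fixes: "x \<in> M \<Longrightarrow> orthogonal_projection M x = x"
  by (rule orthogonal_projection_unique) (auto simp: orthogonal_complement_def)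

lemma orthogonal_projection_eq_0: "x \<in> orthogonal_complement M \<Longrightarrow> orthogonal_projection M x = 0"
  by (rule orthogonal_projection_unique) (auto simp: complex_vector.subspace_0[OF sub])

lemma bounded_clinear_orthogonal_projection: "bounded_clinear (orthogonal_projection M)"
proof (rule bounded_clinearI[where M = 1])
  fix x y c
  show "orthogonal_projection M (x + y) = orthogonal_projection M x + orthogonal_projection M y"
  proof (rule orthogonal_projection_unique)
    have "(x - orthogonal_projection M x) + (y - orthogonal_projection M y) \<in> orthogonal_complement M"
      by (intro complex_vector.subspace_add subspace_orthogonal_complement orthogonal_projection_diff)
    then show "x + y - (orthogonal_projection M x + orthogonal_projection M y) \<in> orthogonal_complement M"
      by (simp add: algebra_simps)
  qed (intro complex_vector.subspace_add sub orthogonal_projection_in)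
  show "orthogonal_projection M (c *\<^sub>C x) = c *\<^sub>C orthogonal_projection M x"
  proof (rule orthogonal_projection_unique)
    have "c *\<^sub>C (x - orthogonal_projection M x) \<in> orthogonal_complement M"
      by (intro complex_vector.subspace_scale subspace_orthogonal_complement orthogonal_projection_diff)
    then show "c *\<^sub>C x - c *\<^sub>C orthogonal_projection M x \<in> orthogonal_complement M"
      by (simp add: complex_vector.scale_right_diff_distrib)
  qed (intro complex_vector.subspace_scale sub orthogonal_projection_in)
  have "cinner (x - orthogonal_projection M x) (orthogonal_projection M x) = 0"
    using orthogonal_projection_in orthogonal_projection_diff by (auto simp: orthogonal_complement_def)
  from norm_add_orthogonal[OF this]
  have "(norm x)\<^sup>2 = (norm (x - orthogonal_projection M x))\<^sup>2 + (norm (orthogonal_projection M x))\<^sup>2"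
    by simp
  then have "(norm (orthogonal_projection M x))\<^sup>2 \<le> (norm x)\<^sup>2" by simp
  then show "norm (orthogonal_projection M x) \<le> 1 * norm x" using power2_le_imp_le by fastforce
qed

lemma cinner_orthogonal_projection:
  "cinner (orthogonal_projection M x) y = cinner x (orthogonal_projection M y)"
proof -
  let ?P = "orthogonal_projection M"
  have "cinner (?P x) (y - ?P y) = 0" "cinner (x - ?P x) (?P y) = 0"
    using orthogonal_projection_in orthogonal_projection_diff
    by (auto simp: orthogonal_complement_def cinner_eq_zero_commute[of "?P x"])
  then show ?thesis by (simp add: cinner_diff_left cinner_diff_right)
qed

end

text \<open>The Riesz representation theorem: the representing vector is a multiple of any nonzero
  vector orthogonal to the kernel.\<close>

lemma riesz_representation:
  fixes f :: "'a::complex_hilbert_space \<Rightarrow> complex"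
  assumes bl: "bounded_linear f" and scale: "\<And>c x. f (c *\<^sub>C x) = c * f x"
  shows "\<exists>v. \<forall>x. f x = cinner x v"
proof (cases "\<forall>x. f x = 0")
  case True
  then show ?thesis by (intro exI[of _ 0]) simp
next
  case False
  then obtain z where z: "f z \<noteq> 0" by blast
  define M where "M = {x. f x = 0}"
  have diff: "f (x - y) = f x - f y" for x y using bl by (simp add: linear_simps)
  have sub: "complex_vector.subspace M"
    using bl by (auto simp: M_def complex_vector.subspace_def scale linear_simps)
  have "closed (f -` {0})"
    by (intro closed_vimage linear_continuous_on bl) auto
  moreover have "f -` {0} = M" by (auto simp: M_def)
  ultimately have cl: "closed M" by simp
  define u where "u = z - orthogonal_projection M z"
  have u_perp: "u \<in> orthogonal_complement M"
    unfolding u_def by (rule orthogonal_projection_diff[OF cl sub])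
  have fu: "f u \<noteq> 0"
    using z orthogonal_projection_in[OF cl sub, of z] by (simp add: u_def diff M_def)
  then have u0: "u \<noteq> 0" using bl by (auto simp: linear_simps)
  define v where "v = (cnj (f u) / complex_of_real ((norm u)\<^sup>2)) *\<^sub>C u"
  have "f x = cinner x v" for x
  proof -
    have "x - (f x / f u) *\<^sub>C u \<in> M" using fu by (simp add: M_def diff scale)
    then have "cinner (x - (f x / f u) *\<^sub>C u) u = 0"
      using u_perp by (auto simp: orthogonal_complement_def cinner_eq_zero_commute)
    then have "cinner x u = f x / f u * complex_of_real ((norm u)\<^sup>2)"
      by (simp add: cinner_diff_left cinner_scaleC_left cinner_self)
    then show ?thesis using fu u0 by (simp add: v_def cinner_scaleC_right)
  qed
  then show ?thesis by blast
qed

lemma cadjoint_unique: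
  assumes "\<And>x y. cinner (A x) y = cinner x (B y)"
  shows "cadjoint A = B"
proof -
  have "\<forall>x y. cinner (A x) y = cinner x (cadjoint A y)"
    unfolding cadjoint_def by (rule someI[of _ B]) (simp add: assms)
  then show ?thesis
    by (intro ext cinner_eq_all_imp_eq_right) (metis assms)
qed

lemma self_adjointI: "(\<And>x y. cinner (A x) y = cinner x (A y)) \<Longrightarrow> self_adjoint A"
  unfolding self_adjoint_def by (rule cadjoint_unique)

context
  fixes A :: "'a::complex_hilbert_space \<Rightarrow> 'a"
  assumes A: "bounded_clinear A"
begin

lemma cinner_cadjoint_right: "cinner (A x) y = cinner x (cadjoint A y)"
proof -
  have "\<exists>v. \<forall>x. cinner (A x) y = cinner x v" for y
    using bounded_linear_compose[OF bounded_bilinear.bounded_linear_left[OF bounded_bilinear_cinner]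
        bounded_clinear_imp_bounded_linear[OF A], of y]
    by (intro riesz_representation) (simp_all add: bounded_clinear_scaleC[OF A] cinner_scaleC_left)
  then have "\<exists>B. \<forall>x y. cinner (A x) y = cinner x (B y)" by metis
  then show ?thesis unfolding cadjoint_def by (rule someI2_ex) blast
qed

lemma cinner_cadjoint_left: "cinner (cadjoint A x) y = cinner x (A y)"
  by (metis cinner_cadjoint_right cinner_commute)

lemma bounded_clinear_cadjoint: "bounded_clinear (cadjoint A)"
proof -
  obtain M where M: "M > 0" "\<And>x. norm (A x) \<le> M * norm x"
    using bounded_clinear_bound[OF A] by blast
  show ?thesis
  proof (rule bounded_clinearI[where M = M])
    fix x y c
    show "cadjoint A (x + y) = cadjoint A x + cadjoint A y"
      by (rule cinner_eq_all_imp_eq) (simp add: cinner_cadjoint_left cinner_add_left)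
    show "cadjoint A (c *\<^sub>C x) = c *\<^sub>C cadjoint A x"
      by (rule cinner_eq_all_imp_eq) (simp add: cinner_cadjoint_left cinner_scaleC_left)
    let ?y = "cadjoint A x"
    have "(norm ?y)\<^sup>2 = norm (cinner (A ?y) x)"
      by (simp add: cinner_cadjoint_right cinner_self norm_power)
    also have "\<dots> \<le> M * norm ?y * norm x"
      using M(2)[of ?y] by (intro order_trans[OF norm_cinner_le] mult_right_mono) auto
    finally have "norm ?y * norm ?y \<le> norm ?y * (M * norm x)"
      by (simp add: power2_eq_square mult_ac)
    then show "norm ?y \<le> M * norm x"
      using M(1) by (cases "norm ?y = 0") auto
  qed
qed

lemma norm_square_eq_cinner: "complex_of_real ((norm (A x))\<^sup>2) = cinner (cadjoint A (A x)) x"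
  by (simp only: cinner_cadjoint_left cinner_self)

end

lemma self_adjoint_cinner:
  "bounded_clinear A \<Longrightarrow> self_adjoint A \<Longrightarrow> cinner (A x) y = cinner x (A (y::'a::complex_hilbert_space))"
  by (metis cinner_cadjoint_right self_adjoint_def)

section \<open>Compact operators\<close>

lemma compact_operator_iff_subsequence:
  "compact_operator A \<longleftrightarrow> bounded_clinear A \<and>
    (\<forall>x M. (\<forall>n::nat. norm (x n) \<le> M) \<longrightarrow> (\<exists>r l. strict_mono r \<and> (\<lambda>n. A (x (r n))) \<longlonglongrightarrow> l))"
    (is "_ \<longleftrightarrow> ?bcl \<and> ?seq")
proof (intro iffI conjI)
  assume comp: "compact_operator A"
  then show A: ?bcl by (simp add: compact_operator_def)
  show ?seq
  proof (intro allI impI)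
    fix x :: "nat \<Rightarrow> 'a" and M assume M: "\<forall>n. norm (x n) \<le> M"
    \<comment> \<open>Adding \<open>1\<close> keeps the scaling factor positive even if the sequence is zero.\<close>
    define R where "R = M + 1"
    have R: "R > 0" using M norm_ge_zero[of "x 0"] unfolding R_def
      by (meson add_nonneg_pos order_trans zero_less_one)
    define z where "z n = complex_of_real (1 / R) *\<^sub>C x n" for n
    have "norm (z n) \<le> 1" for n
      using R M[rule_format, of n] unfolding z_def norm_scaleC norm_of_real
      by (simp add: R_def)
    then have "A (z n) \<in> closure (A ` cball 0 1)" for n
      by (intro closure_subset[THEN subsetD]) auto
    moreover have "seq_compact (closure (A ` cball 0 1))"
      using comp by (simp add: compact_operator_def compact_imp_seq_compact)
    ultimately obtain l r where r: "strict_mono r" and l: "((\<lambda>n. A (z n)) \<circ> r) \<longlonglongrightarrow> l"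
      by (metis seq_compactE)
    have "(\<lambda>n. complex_of_real R *\<^sub>C A (z (r n))) \<longlonglongrightarrow> complex_of_real R *\<^sub>C l"
      using l by (intro tendsto_scaleC tendsto_const) (simp add: o_def)
    moreover have "complex_of_real R *\<^sub>C A (z n) = A (x n)" for n
      using R by (simp add: z_def bounded_clinear_scaleC[OF A, symmetric] scaleC_scaleC)
    ultimately show "\<exists>r l. strict_mono r \<and> (\<lambda>n. A (x (r n))) \<longlonglongrightarrow> l"
      using r by auto
  qed
next
  assume rhs: "?bcl \<and> ?seq"
  have "seq_compact (closure (A ` cball 0 1))"
    unfolding seq_compact_def
  proof (intro allI impI)
    fix f :: "nat \<Rightarrow> 'a" assume "\<forall>n. f n \<in> closure (A ` cball 0 1)"
    then have "\<exists>x. norm x \<le> 1 \<and> dist (A x) (f n) < inverse (real (Suc n))" for n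
      using closure_approachableD[of "f n" "A ` cball 0 1" "inverse (real (Suc n))"]
      by (auto simp: dist_commute)
    then obtain x where x: "\<And>n. norm (x n) \<le> 1"
      and near: "\<And>n. dist (A (x n)) (f n) < inverse (real (Suc n))" by metis
    from rhs x obtain r l where r: "strict_mono r" and l: "(\<lambda>n. A (x (r n))) \<longlonglongrightarrow> l" by blast
    have "norm (A (x n) - f n) \<le> inverse (real (Suc n))" for n
      using near[of n] unfolding dist_norm by linarith
    then have "(\<lambda>n. A (x n) - f n) \<longlonglongrightarrow> 0"
      by (intro Lim_null_comparison[OF _ LIMSEQ_inverse_real_of_nat] always_eventually allI)
    from LIMSEQ_subseq_LIMSEQ[OF this r]
    have "(\<lambda>n. A (x (r n)) - (A (x (r n)) - f (r n))) \<longlonglongrightarrow> l - 0"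
      using l by (intro tendsto_diff) (auto simp: o_def)
    then have "(f \<circ> r) \<longlonglongrightarrow> l" by (simp add: o_def)
    moreover from this have "l \<in> closure (A ` cball 0 1)"
      using \<open>\<forall>n. f n \<in> _\<close> closed_sequentially[OF closed_closure] by (metis comp_apply)
    ultimately show "\<exists>l\<in>closure (A ` cball 0 1). \<exists>r. strict_mono r \<and> (f \<circ> r) \<longlonglongrightarrow> l"
      using r by blast
  qed
  then show "compact_operator A"
    using rhs by (simp add: compact_operator_def compact_eq_seq_compact_metric)
qed

lemma compact_operator_imp_bounded_clinear: "compact_operator A \<Longrightarrow> bounded_clinear A"
  by (simp add: compact_operator_def)

lemma compact_operator_subsequence:
  assumes "compact_operator A" "\<And>n::nat. norm (x n) \<le> M"
  obtains r l where "strict_mono r" "(\<lambda>n. A (x (r n))) \<longlonglongrightarrow> l"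
  using assms unfolding compact_operator_iff_subsequence by blast

lemma compact_operatorI:
  assumes "bounded_clinear A"
    and "\<And>x M. (\<And>n::nat. norm (x n) \<le> M) \<Longrightarrow> \<exists>r l. strict_mono r \<and> (\<lambda>n. A (x (r n))) \<longlonglongrightarrow> l"
  shows "compact_operator A"
  using assms by (auto simp: compact_operator_iff_subsequence)

lemma compact_operator_plus:
  assumes A: "compact_operator A" and B: "compact_operator B"
  shows "compact_operator (\<lambda>x. A x + B x)"
proof (rule compact_operatorI)
  show "bounded_clinear (\<lambda>x. A x + B x)"
    using A B by (intro bounded_clinear_plus compact_operator_imp_bounded_clinear)
  fix x :: "nat \<Rightarrow> 'a" and M assume x: "\<And>n. norm (x n) \<le> M"
  obtain r l where r: "strict_mono r" "(\<lambda>n. A (x (r n))) \<longlonglongrightarrow> l"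
    by (rule compact_operator_subsequence[OF A x])
  obtain r' l' where r': "strict_mono r'" "(\<lambda>n. B (x (r (r' n)))) \<longlonglongrightarrow> l'"
    by (rule compact_operator_subsequence[OF B, of "\<lambda>n. x (r n)"]) (rule x)
  have "(\<lambda>n. A (x (r (r' n)))) \<longlonglongrightarrow> l"
    using LIMSEQ_subseq_LIMSEQ[OF r(2) r'(1)] by (simp add: o_def)
  from tendsto_add[OF this r'(2)] strict_mono_o[OF r(1) r'(1)]
  show "\<exists>r l. strict_mono r \<and> (\<lambda>n. A (x (r n)) + B (x (r n))) \<longlonglongrightarrow> l"
    by (auto simp: o_def intro!: exI[of _ "r \<circ> r'"])
qed

lemma compact_operator_compose_left:
  assumes A: "bounded_clinear A" and K: "compact_operator K"
  shows "compact_operator (\<lambda>x. A (K x))"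
proof (rule compact_operatorI)
  show "bounded_clinear (\<lambda>x. A (K x))"
    by (rule bounded_clinear_compose[OF A compact_operator_imp_bounded_clinear[OF K]])
  fix x :: "nat \<Rightarrow> 'a" and M assume x: "\<And>n. norm (x n) \<le> M"
  obtain r l where r: "strict_mono r" "(\<lambda>n. K (x (r n))) \<longlonglongrightarrow> l"
    by (rule compact_operator_subsequence[OF K x])
  then show "\<exists>r l. strict_mono r \<and> (\<lambda>n. A (K (x (r n)))) \<longlonglongrightarrow> l"
    using bounded_clinear_tendsto[OF A] by blast
qed

lemma compact_operator_compose_right:
  assumes K: "compact_operator K" and A: "bounded_clinear A"
  shows "compact_operator (\<lambda>x. K (A x))"
proof (rule compact_operatorI)
  show "bounded_clinear (\<lambda>x. K (A x))"
    by (rule bounded_clinear_compose[OF compact_operator_imp_bounded_clinear[OF K] A])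
  fix x :: "nat \<Rightarrow> 'a" and M assume x: "\<And>n. norm (x n) \<le> M"
  obtain N where N: "N > 0" "\<And>x. norm (A x) \<le> N * norm x" using bounded_clinear_bound[OF A] by blast
  have "norm (A (x n)) \<le> N * M" for n
    using N(2)[of "x n"] x[of n] N(1) by (meson less_imp_le mult_left_mono order_trans)
  then obtain r l where "strict_mono r" "(\<lambda>n. K (A (x (r n)))) \<longlonglongrightarrow> l"
    by (rule compact_operator_subsequence[OF K, of "\<lambda>n. A (x n)"])
  then show "\<exists>r l. strict_mono r \<and> (\<lambda>n. K (A (x (r n)))) \<longlonglongrightarrow> l" by blast
qed

text \<open>Schauder's theorem, by the identity \<open>\<parallel>K\<^sup>*x\<parallel>\<^sup>2 = \<langle>x, K K\<^sup>*x\<rangle>\<close>: along a bounded sequence on which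
  \<open>K K\<^sup>*\<close> converges, \<open>K\<^sup>*\<close> is Cauchy.\<close>

lemma compact_operator_cadjoint:
  fixes K :: "'a::complex_hilbert_space \<Rightarrow> 'a"
  assumes K: "compact_operator K"
  shows "compact_operator (cadjoint K)"
proof (rule compact_operatorI)
  have bcl: "bounded_clinear K" using K by (rule compact_operator_imp_bounded_clinear)
  then show adj: "bounded_clinear (cadjoint K)" by (rule bounded_clinear_cadjoint)
  fix x :: "nat \<Rightarrow> 'a" and M assume x: "\<And>n. norm (x n) \<le> M"
  obtain r l where r: "strict_mono r" and l: "(\<lambda>n. K (cadjoint K (x (r n)))) \<longlonglongrightarrow> l"
    by (rule compact_operator_subsequence[OF compact_operator_compose_right[OF K adj] x])
  let ?z = "\<lambda>n. K (cadjoint K (x (r n)))" and ?y = "\<lambda>n. cadjoint K (x (r n))"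
  have M: "0 \<le> M" using x[of 0] norm_ge_zero order_trans by blast
  have square: "(norm (?y m - ?y n))\<^sup>2 \<le> (2 * M) * norm (?z m - ?z n)" for m n
  proof -
    let ?d = "x (r m) - x (r n)"
    have "(norm (cadjoint K ?d))\<^sup>2 = norm (cinner ?d (K (cadjoint K ?d)))"
      by (simp add: cinner_cadjoint_left[OF bcl, symmetric] cinner_self norm_power)
    also have "\<dots> \<le> norm ?d * norm (K (cadjoint K ?d))" by (rule norm_cinner_le)
    also have "norm ?d \<le> 2 * M"
      using norm_triangle_ineq4[of "x (r m)" "x (r n)"] x[of "r m"] x[of "r n"] by linarith
    finally show ?thesis
      by (simp add: bounded_clinear_diff[OF adj] bounded_clinear_diff[OF bcl] mult_right_mono)
  qed
  have "Cauchy ?y"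
  proof (rule CauchyI)
    fix e :: real assume e: "e > 0"
    then have "e\<^sup>2 / (2 * M + 1) > 0" using M by simp
    then obtain N where N: "\<And>m n. m \<ge> N \<Longrightarrow> n \<ge> N \<Longrightarrow> norm (?z m - ?z n) < e\<^sup>2 / (2 * M + 1)"
      using CauchyD[OF LIMSEQ_imp_Cauchy[OF l]] by meson
    have "norm (?y m - ?y n) < e" if "m \<ge> N" "n \<ge> N" for m n
    proof -
      have "(norm (?y m - ?y n))\<^sup>2 \<le> (2 * M + 1) * norm (?z m - ?z n)"
        by (rule order_trans[OF square]) (simp add: mult_right_mono)
      also have "\<dots> < e\<^sup>2" using N[OF that] M by (simp add: field_simps)
      finally show ?thesis using e by (simp add: power_less_imp_less_base)
    qed
    then show "\<exists>N. \<forall>m\<ge>N. \<forall>n\<ge>N. norm (?y m - ?y n) < e" by blast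
  qed
  then show "\<exists>r l. strict_mono r \<and> (\<lambda>n. cadjoint K (x (r n))) \<longlonglongrightarrow> l"
    using r Cauchy_convergent convergent_def by blast
qed

lemma compact_operator_finite_rank:
  fixes u v :: "'i \<Rightarrow> 'a::complex_inner_space"
  assumes "finite J"
  shows "compact_operator (\<lambda>x. \<Sum>i\<in>J. cinner x (u i) *\<^sub>C v i)"
  using assms
proof (induction J)
  case empty
  show ?case
  proof (rule compact_operatorI)
    show "bounded_clinear (\<lambda>x. \<Sum>i\<in>{}. cinner x (u i) *\<^sub>C v i)"
      by (rule bounded_clinearI[where M = 0]) simp_all
    show "\<exists>r l. strict_mono r \<and> (\<lambda>n. \<Sum>i\<in>{}. cinner (x (r n)) (u i) *\<^sub>C v i) \<longlonglongrightarrow> l"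
      for x :: "nat \<Rightarrow> 'a"
      by (intro exI[of _ id] exI[of _ 0]) (simp add: strict_mono_id)
  qed
next
  case (insert i J)
  have "compact_operator (\<lambda>x. cinner x (u i) *\<^sub>C v i)"
  proof (rule compact_operatorI)
    show "bounded_clinear (\<lambda>x. cinner x (u i) *\<^sub>C v i)"
    proof (rule bounded_clinearI[where M = "norm (u i) * norm (v i)"])
      show "norm (cinner x (u i) *\<^sub>C v i) \<le> norm (u i) * norm (v i) * norm x" for x
        using mult_right_mono[OF norm_cinner_le[of x "u i"], of "norm (v i)"]
        by (simp add: norm_scaleC mult_ac)
    qed (simp_all add: cinner_add_left scaleC_add_left cinner_scaleC_left scaleC_scaleC)
    fix x :: "nat \<Rightarrow> 'a" and M assume x: "\<And>n. norm (x n) \<le> M"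
    have "norm (cinner (x n) (u i)) \<le> M * norm (u i)" for n
      using norm_cinner_le[of "x n" "u i"] mult_right_mono[OF x[of n], of "norm (u i)"] by simp
    then have "bounded (range (\<lambda>n. cinner (x n) (u i)))"
      by (auto simp: bounded_iff)
    then obtain l r where r: "strict_mono r" "((\<lambda>n. cinner (x n) (u i)) \<circ> r) \<longlonglongrightarrow> l"
      using bounded_imp_convergent_subsequence by blast
    then have "(\<lambda>n. cinner (x (r n)) (u i) *\<^sub>C v i) \<longlonglongrightarrow> l *\<^sub>C v i"
      by (intro tendsto_scaleC tendsto_const) (simp add: o_def)
    with r show "\<exists>r l. strict_mono r \<and> (\<lambda>n. cinner (x (r n)) (u i) *\<^sub>C v i) \<longlonglongrightarrow> l" by blast
  qed
  from compact_operator_plus[OF this insert.IH] insert.hyps show ?case by simp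
qed

section \<open>Orthonormal families\<close>

text \<open>Zero vectors are admitted, so that the singular vectors of an operator form an infinite
  sequence even if the operator has finite rank.\<close>

definition orthonormal_or_zero :: "'i set \<Rightarrow> ('i \<Rightarrow> 'a::complex_inner_space) \<Rightarrow> bool" where
  "orthonormal_or_zero J e \<longleftrightarrow> (\<forall>i\<in>J. e i = 0 \<or> norm (e i) = 1) \<and>
     (\<forall>i\<in>J. \<forall>j\<in>J. i \<noteq> j \<longrightarrow> cinner (e i) (e j) = 0)"

definition fourier_sum :: "'i set \<Rightarrow> ('i \<Rightarrow> 'a::complex_inner_space) \<Rightarrow> 'a \<Rightarrow> 'a" where
  "fourier_sum J e x = (\<Sum>i\<in>J. cinner x (e i) *\<^sub>C e i)"

lemma orthonormal_or_zero_subset: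
  "orthonormal_or_zero J e \<Longrightarrow> I \<subseteq> J \<Longrightarrow> orthonormal_or_zero I e"
  by (simp add: orthonormal_or_zero_def subset_eq)

lemma cinner_sum_right: "cinner y (\<Sum>i\<in>J. f i) = (\<Sum>i\<in>J. cinner y (f i))"
  by (induction J rule: infinite_finite_induct) (auto simp: cinner_add_right)

lemma norm_sum_orthogonal:
  fixes f :: "'i \<Rightarrow> 'a::complex_inner_space"
  assumes "finite J" "\<And>i j. i \<in> J \<Longrightarrow> j \<in> J \<Longrightarrow> i \<noteq> j \<Longrightarrow> cinner (f i) (f j) = 0"
  shows "(norm (\<Sum>i\<in>J. f i))\<^sup>2 = (\<Sum>i\<in>J. (norm (f i))\<^sup>2)"
  using assms
proof (induction J)
  case (insert i J)
  have "cinner (f i) (\<Sum>i\<in>J. f i) = 0"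
    unfolding cinner_sum_right using insert.hyps insert.prems by (intro sum.neutral) auto
  then show ?case
    using insert by (simp add: norm_add_orthogonal)
qed simp

lemma norm_orthogonal_combination:
  assumes "finite J" "orthonormal_or_zero J e"
  shows "(norm (\<Sum>i\<in>J. c i *\<^sub>C e i))\<^sup>2 = (\<Sum>i\<in>J. (norm (c i))\<^sup>2 * (norm (e i))\<^sup>2)"
proof -
  have "(norm (\<Sum>i\<in>J. c i *\<^sub>C e i))\<^sup>2 = (\<Sum>i\<in>J. (norm (c i *\<^sub>C e i))\<^sup>2)"
    using assms by (intro norm_sum_orthogonal)
      (auto simp: orthonormal_or_zero_def cinner_scaleC_left cinner_scaleC_right)
  then show ?thesis by (simp add: norm_scaleC power_mult_distrib)
qed

lemma cinner_orthogonal_combination: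
  assumes "finite J" "orthonormal_or_zero J e" "i \<in> J"
  shows "cinner (\<Sum>j\<in>J. c j *\<^sub>C e j) (e i) = c i * complex_of_real ((norm (e i))\<^sup>2)"
proof -
  have "cinner (\<Sum>j\<in>J. c j *\<^sub>C e j) (e i) = (\<Sum>j\<in>J. c j * cinner (e j) (e i))"
    by (simp add: cinner_sum_left cinner_scaleC_left)
  also have "\<dots> = (\<Sum>j\<in>J. if j = i then c i * cinner (e i) (e i) else 0)"
    using assms by (intro sum.cong) (auto simp: orthonormal_or_zero_def)
  finally show ?thesis using assms by (simp add: cinner_self)
qed

lemma cinner_fourier_sum:
  assumes "finite J" "orthonormal_or_zero J e" "i \<in> J"
  shows "cinner (fourier_sum J e x) (e i) = cinner x (e i)"
  unfolding fourier_sum_def cinner_orthogonal_combination[OF assms]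
  using assms by (auto simp: orthonormal_or_zero_def)

lemma fourier_sum_residual:
  assumes "finite J" "orthonormal_or_zero J e" "i \<in> J"
  shows "cinner (x - fourier_sum J e x) (e i) = 0"
  by (simp add: cinner_diff_left cinner_fourier_sum[OF assms])

lemma norm_fourier_sum_residual:
  assumes "finite J" "orthonormal_or_zero J e"
  shows "(norm x)\<^sup>2 = (norm (x - fourier_sum J e x))\<^sup>2 + (norm (fourier_sum J e x))\<^sup>2"
proof -
  have "cinner (x - fourier_sum J e x) (fourier_sum J e x) = 0"
    by (subst (2) fourier_sum_def)
      (simp add: cinner_sum_right cinner_scaleC_right fourier_sum_residual[OF assms])
  from norm_add_orthogonal[OF this] show ?thesis by simp
qed

lemma bessel_weighted:
  assumes J: "finite J" "orthonormal_or_zero J e" and w: "\<And>i. i \<in> J \<Longrightarrow> norm (w i) \<le> W"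
    and W: "0 \<le> W"
  shows "norm (\<Sum>i\<in>J. (w i * cinner x (e i)) *\<^sub>C e i) \<le> W * norm x"
proof -
  have "(norm (\<Sum>i\<in>J. (w i * cinner x (e i)) *\<^sub>C e i))\<^sup>2
      = (\<Sum>i\<in>J. (norm (w i))\<^sup>2 * ((norm (cinner x (e i)))\<^sup>2 * (norm (e i))\<^sup>2))"
    by (simp add: norm_orthogonal_combination[OF J] norm_mult power_mult_distrib mult.assoc)
  also have "\<dots> \<le> (\<Sum>i\<in>J. W\<^sup>2 * ((norm (cinner x (e i)))\<^sup>2 * (norm (e i))\<^sup>2))"
    using w by (intro sum_mono mult_right_mono power_mono) auto
  also have "\<dots> = W\<^sup>2 * (norm (fourier_sum J e x))\<^sup>2"
    unfolding fourier_sum_def by (simp add: norm_orthogonal_combination[OF J] sum_distrib_left)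
  also have "\<dots> \<le> W\<^sup>2 * (norm x)\<^sup>2"
    using norm_fourier_sum_residual[OF J, of x] by (intro mult_left_mono) auto
  finally have "(norm (\<Sum>i\<in>J. (w i * cinner x (e i)) *\<^sub>C e i))\<^sup>2 \<le> (W * norm x)\<^sup>2"
    by (simp only: power_mult_distrib)
  then show ?thesis by (rule power2_le_imp_le) (simp add: W)
qed

lemma norm_residual_le:
  assumes "finite J" "orthonormal_or_zero J e"
  shows "norm (x - fourier_sum J e x) \<le> norm x"
  by (rule power2_le_imp_le) (use norm_fourier_sum_residual[OF assms, of x] in auto)

lemma gram_schmidt:
  fixes B :: "'a::complex_inner_space set"
  assumes "finite B"
  shows "\<exists>E. finite E \<and> orthonormal_or_zero E (\<lambda>x. x) \<and> cspan E = cspan B"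
  using assms
proof (induction B)
  case empty
  show ?case by (intro exI[of _ "{}"]) (simp add: orthonormal_or_zero_def)
next
  case (insert b B)
  then obtain E where E: "finite E" "orthonormal_or_zero E (\<lambda>x. x)" and sp: "cspan E = cspan B"
    by blast
  define w where "w = b - fourier_sum E (\<lambda>x. x) b"
  define u where "u = complex_of_real (1 / norm w) *\<^sub>C w"
  have proj: "fourier_sum E (\<lambda>x. x) b \<in> cspan E"
    unfolding fourier_sum_def
    by (intro complex_vector.span_sum complex_vector.span_scale complex_vector.span_base)
  \<comment> \<open>If \<open>b\<close> is in the span already, then \<open>w = 0\<close> and \<open>u = 0\<close>, which the notion of family admits.\<close>
  have perp: "cinner u v = 0" if "v \<in> E" for v
    using fourier_sum_residual[OF E that, of b] by (simp add: u_def w_def cinner_scaleC_left)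
  then have perp': "cinner v u = 0" if "v \<in> E" for v
    using that cinner_eq_zero_commute[of v u] by simp
  have unit: "u = 0 \<or> norm u = 1" by (simp add: u_def norm_scaleC norm_divide)
  have w_u: "w = complex_of_real (norm w) *\<^sub>C u" by (simp add: u_def scaleC_scaleC)
  have "orthonormal_or_zero (insert u E) (\<lambda>x. x)"
    using E perp perp' unit by (auto simp: orthonormal_or_zero_def)
  moreover have "cspan (insert u E) = cspan (insert b B)"
  proof (subst complex_vector.span_eq, intro conjI)
    have mono: "cspan E \<subseteq> cspan (insert b B)" "cspan E \<subseteq> cspan (insert u E)"
      using complex_vector.span_mono[of B "insert b B"] complex_vector.span_mono[of E "insert u E"]
      by (auto simp: sp)
    have "w \<in> cspan (insert b B)"
      unfolding w_def using proj mono
      by (intro complex_vector.span_diff complex_vector.span_base[of b]) auto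
    then have "u \<in> cspan (insert b B)" unfolding u_def by (rule complex_vector.span_scale)
    then show "insert u E \<subseteq> cspan (insert b B)"
      using mono complex_vector.span_superset[of E] by auto
    have "w + fourier_sum E (\<lambda>x. x) b \<in> cspan (insert u E)"
      using proj mono
      by (intro complex_vector.span_add, subst w_u)
        (auto intro: complex_vector.span_scale complex_vector.span_base)
    then have "b \<in> cspan (insert u E)" by (simp add: w_def)
    then show "insert b B \<subseteq> cspan (insert u E)"
      using mono sp complex_vector.span_superset[of B] by auto
  qed
  ultimately show ?case using E(1) by blast
qed

text \<open>Gaussian elimination: a homogeneous system with fewer equations than unknowns has a nontrivial
  solution.\<close>

lemma homogeneous_system_solution:
  fixes M :: "'i \<Rightarrow> 'f \<Rightarrow> complex"
  assumes "finite F" "finite J" "card F < card J"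
  shows "\<exists>a. (\<exists>i\<in>J. a i \<noteq> 0) \<and> (\<forall>f\<in>F. (\<Sum>i\<in>J. a i * M i f) = 0)"
  using assms
proof (induction F arbitrary: J M)
  case empty
  then have "J \<noteq> {}" by auto
  then show ?case by (intro exI[of _ "\<lambda>_. 1"]) auto
next
  case (insert f F)
  show ?case
  proof (cases "\<forall>i\<in>J. M i f = 0")
    case True
    obtain a where "\<exists>i\<in>J. a i \<noteq> 0" "\<forall>g\<in>F. (\<Sum>i\<in>J. a i * M i g) = 0"
      using insert.IH[of J M] insert.prems insert.hyps by auto
    then show ?thesis using True by (intro exI[of _ a]) auto
  next
    case False
    then obtain k where k: "k \<in> J" "M k f \<noteq> 0" by blast
    \<comment> \<open>Equation \<open>f\<close> expresses the unknown \<open>k\<close> by the others; \<open>N\<close> is the system that remains.\<close>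
    define N where "N i g = M i g - M i f / M k f * M k g" for i g
    have "card F < card (J - {k})"
      using insert.prems insert.hyps k by simp
    then obtain a where a: "\<exists>i\<in>J - {k}. a i \<noteq> 0"
      and sol: "\<forall>g\<in>F. (\<Sum>i\<in>J - {k}. a i * N i g) = 0"
      using insert.IH[of "J - {k}" N] insert.prems by auto
    define b where "b = a(k := - (\<Sum>i\<in>J - {k}. a i * M i f) / M k f)"
    have eliminate: "(\<Sum>i\<in>J. b i * M i g) = (\<Sum>i\<in>J - {k}. a i * N i g)" for g
    proof -
      have "(\<Sum>i\<in>J. b i * M i g) = b k * M k g + (\<Sum>i\<in>J - {k}. b i * M i g)"
        using k insert.prems by (simp add: sum.remove)
      also have "(\<Sum>i\<in>J - {k}. b i * M i g) = (\<Sum>i\<in>J - {k}. a i * M i g)"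
        by (intro sum.cong) (auto simp: b_def)
      also have "b k * M k g = - (\<Sum>i\<in>J - {k}. a i * (M i f / M k f * M k g))"
        by (simp add: b_def sum_distrib_right sum_divide_distrib mult.assoc)
      finally show ?thesis by (simp add: N_def algebra_simps sum_subtractf)
    qed
    have "N i f = 0" for i using k by (simp add: N_def)
    then have "\<forall>g\<in>insert f F. (\<Sum>i\<in>J. b i * M i g) = 0" using sol by (simp add: eliminate)
    moreover have "\<exists>i\<in>J. b i \<noteq> 0" using a by (auto simp: b_def)
    ultimately show ?thesis by blast
  qed
qed

section \<open>Singular systems of compact operators\<close>

text \<open>The singular vectors \<open>e\<close> diagonalize \<open>A\<^sup>*A\<close>; the singular number \<open>\<mu> n\<close> is the norm of \<open>A\<close> on the
  orthogonal complement of the first \<open>n\<close> of them. Once this norm is zero, the sequence continues with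
  zero vectors.\<close>

locale singular_system =
  fixes A :: "'a::complex_hilbert_space \<Rightarrow> 'a" and e :: "nat \<Rightarrow> 'a" and \<mu> :: "nat \<Rightarrow> real"
  assumes compact: "compact_operator A"
    and family: "orthonormal_or_zero UNIV e"
    and zero_iff: "e n = 0 \<longleftrightarrow> \<mu> n = 0"
    and nonneg: "0 \<le> \<mu> n"
    and eigen: "cadjoint A (A (e n)) = complex_of_real ((\<mu> n)\<^sup>2) *\<^sub>C e n"
    and bound: "(\<And>k. k < n \<Longrightarrow> cinner x (e k) = 0) \<Longrightarrow> norm (A x) \<le> \<mu> n * norm x"

text \<open>On the orthogonal complement \<open>E\<^sup>\<bottom>\<close> of eigenvectors of \<open>B = A\<^sup>*A\<close>, which \<open>B\<close> leaves invariant,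
  let \<open>\<mu>\<close> be the norm of \<open>A\<close> and let \<open>\<parallel>x\<^sub>n\<parallel> \<le> 1\<close> with \<open>\<parallel>A x\<^sub>n\<parallel> \<longlonglongrightarrow> \<mu>\<close>. Then
  \<open>\<parallel>B x\<^sub>n - \<mu>\<^sup>2 x\<^sub>n\<parallel>\<^sup>2 \<le> 2 \<mu>\<^sup>2 (\<mu>\<^sup>2 - \<parallel>A x\<^sub>n\<parallel>\<^sup>2) \<longlonglongrightarrow> 0\<close>, so where \<open>B x\<^sub>n\<close> converges, \<open>x\<^sub>n\<close> converges to an
  eigenvector.\<close>

lemma next_singular_vector:
  fixes A :: "'a::complex_hilbert_space \<Rightarrow> 'a"
  assumes comp: "compact_operator A"
    and eig: "\<And>v. v \<in> E \<Longrightarrow> \<exists>c. cadjoint A (A v) = complex_of_real c *\<^sub>C v"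
  shows "\<exists>v \<mu>. 0 \<le> \<mu> \<and> v \<in> orthogonal_complement E \<and>
    cadjoint A (A v) = complex_of_real (\<mu>\<^sup>2) *\<^sub>C v \<and> (v = 0 \<longleftrightarrow> \<mu> = 0) \<and> (v = 0 \<or> norm v = 1) \<and>
    (\<forall>x\<in>orthogonal_complement E. norm (A x) \<le> \<mu> * norm x)"
proof -
  let ?H = "orthogonal_complement E"
  define B where "B x = cadjoint A (A x)" for x
  have A: "bounded_clinear A" using comp by (rule compact_operator_imp_bounded_clinear)
  have compB: "compact_operator B"
    unfolding B_def by (rule compact_operator_compose_left[OF bounded_clinear_cadjoint[OF A] comp])
  have B: "bounded_clinear B" using compB by (rule compact_operator_imp_bounded_clinear)
  have B_left: "cinner (B x) y = cinner (A x) (A y)" for x y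
    by (simp add: B_def cinner_cadjoint_left[OF A])
  have B_sym: "cinner (B x) y = cinner x (B y)" for x y
    unfolding B_left unfolding B_def by (rule cinner_cadjoint_right[OF A])
  define \<mu> where "\<mu> = Sup ((\<lambda>x. norm (A x)) ` {x \<in> ?H. norm x \<le> 1})"
  obtain M where M: "M > 0" "\<And>x. norm (A x) \<le> M * norm x" using bounded_clinear_bound[OF A] by blast
  have bdd: "bdd_above ((\<lambda>x. norm (A x)) ` {x \<in> ?H. norm x \<le> 1})"
  proof (rule bdd_aboveI2)
    fix x assume "x \<in> {x \<in> ?H. norm x \<le> 1}"
    then have "M * norm x \<le> M * 1" using M(1) by (intro mult_left_mono) auto
    with M(2)[of x] show "norm (A x) \<le> M" by simp
  qed
  have zero_H: "0 \<in> ?H" by (rule complex_vector.subspace_0[OF subspace_orthogonal_complement])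
  have unit_bound: "norm (A x) \<le> \<mu>" if "x \<in> ?H" "norm x \<le> 1" for x
    unfolding \<mu>_def using that by (intro cSUP_upper bdd) auto
  have \<mu>0: "0 \<le> \<mu>" using unit_bound[OF zero_H] by (simp add: bounded_clinear_zero[OF A])
  have bnd: "norm (A x) \<le> \<mu> * norm x" if "x \<in> ?H" for x
  proof (cases "x = 0")
    case False
    have "norm (A (complex_of_real (1 / norm x) *\<^sub>C x)) \<le> \<mu>"
      using that False
      by (intro unit_bound complex_vector.subspace_scale[OF subspace_orthogonal_complement])
        (auto simp: norm_scaleC norm_divide)
    then show ?thesis using False
      by (simp add: bounded_clinear_scaleC[OF A] norm_scaleC norm_divide divide_simps)
  qed (simp add: bounded_clinear_zero[OF A])
  show ?thesis
  proof (cases "\<mu> = 0")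
    case True
    then show ?thesis
      using bnd zero_H bounded_clinear_zero[OF B]
      by (intro exI[of _ 0] exI[of _ "0::real"]) (auto simp: B_def)
  next
    case False
    then have pos: "\<mu> > 0" using \<mu>0 by simp
    have B_H: "B x \<in> ?H" if "x \<in> ?H" for x
      unfolding orthogonal_complement_def mem_Collect_eq
    proof
      fix v assume v: "v \<in> E"
      then obtain c where "B v = complex_of_real c *\<^sub>C v" using eig by (auto simp: B_def)
      then show "cinner (B x) v = 0"
        using that v by (simp add: B_sym cinner_scaleC_right orthogonal_complement_def)
    qed
    have norm_B: "norm (B x) \<le> \<mu>\<^sup>2" if x: "x \<in> ?H" "norm x \<le> 1" for x
    proof -
      have "(norm (B x))\<^sup>2 = norm (cinner (A x) (A (B x)))"
        by (simp add: B_left[symmetric] cinner_self norm_power)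
      also have "\<dots> \<le> norm (A x) * norm (A (B x))" by (rule norm_cinner_le)
      also have "\<dots> \<le> \<mu> * (\<mu> * norm (B x))"
        using unit_bound[OF x] bnd[OF B_H[OF x(1)]] \<mu>0 by (intro mult_mono) auto
      finally have "norm (B x) * norm (B x) \<le> norm (B x) * \<mu>\<^sup>2"
        by (simp add: power2_eq_square mult_ac)
      then show ?thesis by (cases "norm (B x) = 0") auto
    qed
    have "\<exists>x. x \<in> ?H \<and> norm x \<le> 1 \<and> \<mu> - inverse (real (Suc n)) < norm (A x)" for n
    proof -
      have "(\<lambda>x. norm (A x)) ` {x \<in> ?H. norm x \<le> 1} \<noteq> {}" using zero_H by auto
      then show ?thesis
        using less_cSupD[of "(\<lambda>x. norm (A x)) ` {x \<in> ?H. norm x \<le> 1}" "\<mu> - inverse (real (Suc n))"]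
        by (auto simp: \<mu>_def)
    qed
    then obtain x where x: "\<And>n. x n \<in> ?H" "\<And>n. norm (x n) \<le> 1"
      and x_near: "\<And>n. \<mu> - inverse (real (Suc n)) < norm (A (x n))" by metis
    have "(\<lambda>n. \<mu> - inverse (real (Suc n))) \<longlonglongrightarrow> \<mu> - 0"
      by (intro tendsto_intros LIMSEQ_inverse_real_of_nat)
    then have lower: "(\<lambda>n. \<mu> - inverse (real (Suc n))) \<longlonglongrightarrow> \<mu>" by simp
    have norm_lim: "(\<lambda>n. norm (A (x n))) \<longlonglongrightarrow> \<mu>"
      by (rule real_tendsto_sandwich[OF _ _ lower tendsto_const])
        (auto intro!: always_eventually less_imp_le[OF x_near] unit_bound[OF x] simp del: of_nat_Suc)
    define d where "d n = B (x n) - complex_of_real (\<mu>\<^sup>2) *\<^sub>C x n" for n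
    have d_le: "(norm (d n))\<^sup>2 \<le> 2 * \<mu>\<^sup>2 * (\<mu>\<^sup>2 - (norm (A (x n)))\<^sup>2)" for n
    proof -
      have "Re (cinner (B (x n)) (complex_of_real (\<mu>\<^sup>2) *\<^sub>C x n)) = \<mu>\<^sup>2 * (norm (A (x n)))\<^sup>2"
        unfolding cinner_scaleC_right B_left cinner_self by simp
      moreover have "(norm (B (x n)))\<^sup>2 \<le> (\<mu>\<^sup>2)\<^sup>2"
        using norm_B[OF x] by (rule power_mono) simp
      moreover have "(norm (complex_of_real (\<mu>\<^sup>2) *\<^sub>C x n))\<^sup>2 \<le> (\<mu>\<^sup>2)\<^sup>2"
        using x(2)[of n] by (intro power_mono) (auto simp: norm_scaleC norm_power mult_left_le)
      ultimately show ?thesis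
        unfolding d_def norm_diff_square by (simp add: algebra_simps power2_eq_square)
    qed
    have "(\<lambda>n. 2 * \<mu>\<^sup>2 * (\<mu>\<^sup>2 - (norm (A (x n)))\<^sup>2)) \<longlonglongrightarrow> 2 * \<mu>\<^sup>2 * (\<mu>\<^sup>2 - \<mu>\<^sup>2)"
      by (intro tendsto_intros norm_lim)
    then have upper: "(\<lambda>n. 2 * \<mu>\<^sup>2 * (\<mu>\<^sup>2 - (norm (A (x n)))\<^sup>2)) \<longlonglongrightarrow> 0" by simp
    have "(\<lambda>n. (norm (d n))\<^sup>2) \<longlonglongrightarrow> 0"
      by (rule real_tendsto_sandwich[OF _ _ tendsto_const upper])
        (auto intro!: always_eventually d_le)
    then have "(\<lambda>n. sqrt ((norm (d n))\<^sup>2)) \<longlonglongrightarrow> sqrt 0" by (rule tendsto_real_sqrt)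
    then have d_lim: "d \<longlonglongrightarrow> 0" by (simp add: tendsto_norm_zero_iff)
    obtain r l where r: "strict_mono r" and l: "(\<lambda>n. B (x (r n))) \<longlonglongrightarrow> l"
      by (rule compact_operator_subsequence[OF compB x(2)])
    define v where "v = complex_of_real (1 / \<mu>\<^sup>2) *\<^sub>C l"
    have "(\<lambda>n. d (r n)) \<longlonglongrightarrow> 0" using LIMSEQ_subseq_LIMSEQ[OF d_lim r] by (simp add: o_def)
    from tendsto_diff[OF l this]
    have "(\<lambda>n. complex_of_real (\<mu>\<^sup>2) *\<^sub>C x (r n)) \<longlonglongrightarrow> l" by (simp add: d_def)
    then have "(\<lambda>n. complex_of_real (1 / \<mu>\<^sup>2) *\<^sub>C complex_of_real (\<mu>\<^sup>2) *\<^sub>C x (r n)) \<longlonglongrightarrow> v"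
      unfolding v_def by (intro tendsto_scaleC tendsto_const)
    then have x_lim: "(\<lambda>n. x (r n)) \<longlonglongrightarrow> v" using pos by (simp add: scaleC_scaleC)
    have v_H: "v \<in> ?H" by (rule orthogonal_complement_limit[OF x(1) x_lim])
    have "B v = l"
      using LIMSEQ_unique[OF bounded_clinear_tendsto[OF B x_lim] l] .
    then have Bv: "B v = complex_of_real (\<mu>\<^sup>2) *\<^sub>C v" using pos by (simp add: v_def scaleC_scaleC)
    have "(\<lambda>n. norm (A (x (r n)))) \<longlonglongrightarrow> norm (A v)"
      by (intro tendsto_norm bounded_clinear_tendsto[OF A] x_lim)
    moreover have "(\<lambda>n. norm (A (x (r n)))) \<longlonglongrightarrow> \<mu>"
      using LIMSEQ_subseq_LIMSEQ[OF norm_lim r] by (simp add: o_def)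
    ultimately have "norm (A v) = \<mu>" by (rule LIMSEQ_unique)
    then have "complex_of_real (\<mu>\<^sup>2) = cinner (B v) v"
      unfolding B_def using norm_square_eq_cinner[OF A, of v] by simp
    also have "\<dots> = complex_of_real (\<mu>\<^sup>2 * (norm v)\<^sup>2)"
      by (simp only: Bv cinner_scaleC_left cinner_self of_real_mult)
    finally have "\<mu>\<^sup>2 = \<mu>\<^sup>2 * (norm v)\<^sup>2" using of_real_eq_iff by blast
    then have "(norm v)\<^sup>2 = 1" using pos by simp
    then have v1: "norm v = 1"
      using norm_ge_zero[of v] unfolding power2_eq_1_iff by linarith
    then have "v \<noteq> 0" by auto
    then show ?thesis
      using v_H Bv v1 pos bnd by (intro exI[of _ v] exI[of _ \<mu>]) (auto simp: B_def)
  qed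
qed

lemma singular_system_exists:
  fixes A :: "'a::complex_hilbert_space \<Rightarrow> 'a"
  assumes comp: "compact_operator A"
  shows "\<exists>e \<mu>. singular_system A e \<mu>"
proof -
  define P where "P f n r \<longleftrightarrow> (case r of (v, \<mu>) \<Rightarrow>
    0 \<le> \<mu> \<and> v \<in> orthogonal_complement ((\<lambda>k. fst (f k)) ` {..<n}) \<and>
    cadjoint A (A v) = complex_of_real (\<mu>\<^sup>2) *\<^sub>C v \<and> (v = 0 \<longleftrightarrow> \<mu> = 0) \<and> (v = 0 \<or> norm v = 1) \<and>
    (\<forall>x\<in>orthogonal_complement ((\<lambda>k. fst (f k)) ` {..<n}). norm (A x) \<le> \<mu> * norm x))"
    for f :: "nat \<Rightarrow> 'a \<times> real" and n r
  have "\<exists>f. \<forall>n. P f n (f n)"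
  proof (rule dependent_wellorder_choice)
    fix r :: "'a \<times> real" and f g :: "nat \<Rightarrow> 'a \<times> real" and n :: nat
    assume "\<And>k. k < n \<Longrightarrow> f k = g k"
    then have "(\<lambda>k. fst (f k)) ` {..<n} = (\<lambda>k. fst (g k)) ` {..<n}" by (intro image_cong) auto
    then show "P f n r = P g n r" by (simp add: P_def)
  next
    fix n :: nat and f :: "nat \<Rightarrow> 'a \<times> real"
    assume "\<And>k. k < n \<Longrightarrow> P f k (f k)"
    then have "\<exists>c. cadjoint A (A v) = complex_of_real c *\<^sub>C v" if v: "v \<in> (\<lambda>k. fst (f k)) ` {..<n}" for v
    proof -
      obtain k where "k < n" "v = fst (f k)" using v by blast
      with \<open>\<And>k. k < n \<Longrightarrow> P f k (f k)\<close>[of k] show ?thesis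
        by (intro exI[of _ "(snd (f k))\<^sup>2"]) (auto simp: P_def split: prod.splits)
    qed
    from next_singular_vector[OF comp this] show "\<exists>r. P f n r"
      unfolding P_def split_paired_Ex prod.case .
  qed
  then obtain f where f: "\<And>n. P f n (f n)" by blast
  define e \<mu> where "e n = fst (f n)" and "\<mu> n = snd (f n)" for n
  have step: "0 \<le> \<mu> n" "e n \<in> orthogonal_complement (e ` {..<n})"
    "cadjoint A (A (e n)) = complex_of_real ((\<mu> n)\<^sup>2) *\<^sub>C e n" "e n = 0 \<longleftrightarrow> \<mu> n = 0"
    "e n = 0 \<or> norm (e n) = 1"
    "\<forall>x\<in>orthogonal_complement (e ` {..<n}). norm (A x) \<le> \<mu> n * norm x" for n
    using f[of n] by (auto simp: P_def e_def \<mu>_def split: prod.splits)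
  have "cinner (e m) (e n) = 0" if "m \<noteq> n" for m n
    using that step(2)[of m] step(2)[of n] cinner_eq_zero_commute[of "e m" "e n"]
    by (cases m n rule: linorder_cases) (auto simp: orthogonal_complement_def)
  then have "singular_system A e \<mu>"
    using step comp
    by unfold_locales (auto simp: orthonormal_or_zero_def orthogonal_complement_def)
  then show ?thesis by blast
qed

context singular_system
begin

lemma bounded_clinear: "bounded_clinear A"
  using compact by (rule compact_operator_imp_bounded_clinear)

lemma zero_or_unit: "e n = 0 \<or> norm (e n) = 1"
  using family by (simp add: orthonormal_or_zero_def)

lemma norm_vector_le_1: "norm (e n) \<le> 1"
  using zero_or_unit[of n] by auto

lemma norm_vector: "\<mu> n \<noteq> 0 \<Longrightarrow> norm (e n) = 1"
  using zero_or_unit[of n] zero_iff[of n] by blast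

lemma orthogonal: "m \<noteq> n \<Longrightarrow> cinner (e m) (e n) = 0"
  using family by (simp add: orthonormal_or_zero_def)

lemma family_on: "orthonormal_or_zero J e"
  by (rule orthonormal_or_zero_subset[OF family subset_UNIV])

lemma images_orthogonal:
  assumes "m \<noteq> n"
  shows "cinner (A (e m)) (A (e n)) = 0"
proof -
  have "cinner (A (e m)) (A (e n)) = cinner (cadjoint A (A (e m))) (e n)"
    by (rule cinner_cadjoint_left[OF bounded_clinear, symmetric])
  also have "\<dots> = complex_of_real ((\<mu> m)\<^sup>2) * cinner (e m) (e n)"
    by (simp only: eigen cinner_scaleC_left)
  finally show ?thesis by (simp only: orthogonal[OF assms] mult_zero_right)
qed

lemma norm_image: "norm (A (e n)) = \<mu> n"
proof -
  have "complex_of_real ((norm (A (e n)))\<^sup>2) = complex_of_real ((\<mu> n)\<^sup>2 * (norm (e n))\<^sup>2)"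
    by (simp only: norm_square_eq_cinner[OF bounded_clinear] eigen cinner_scaleC_left cinner_self
        of_real_mult)
  then have "(norm (A (e n)))\<^sup>2 = (\<mu> n)\<^sup>2 * (norm (e n))\<^sup>2" using of_real_eq_iff by blast
  also have "\<dots> = (\<mu> n)\<^sup>2" using norm_vector[of n] by (cases "\<mu> n = 0") auto
  finally show ?thesis using nonneg by (simp add: power2_eq_iff_nonneg)
qed

lemma decseq: "decseq \<mu>"
proof (rule decseq_SucI)
  fix n
  have "norm (A (e (Suc n))) \<le> \<mu> n * norm (e (Suc n))"
    by (rule bound) (simp add: orthogonal)
  also have "\<dots> \<le> \<mu> n * 1" by (intro mult_left_mono norm_vector_le_1 nonneg)
  finally show "\<mu> (Suc n) \<le> \<mu> n" by (simp add: norm_image)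
qed

text \<open>The images of the singular vectors are orthogonal with norms \<open>\<mu> n\<close>. If all norms were at least
  \<open>r\<close>, the images would have mutual distances at least \<open>r\<close> and no convergent subsequence.\<close>

lemma eventually_small:
  assumes "r > 0"
  shows "\<exists>n. \<mu> n < r"
proof (rule ccontr)
  assume "\<nexists>n. \<mu> n < r"
  then have large: "r \<le> \<mu> n" for n by (simp add: not_less)
  obtain s l where s: "strict_mono s" and l: "(\<lambda>n. A (e (s n))) \<longlonglongrightarrow> l"
    by (rule compact_operator_subsequence[OF compact norm_vector_le_1])
  obtain N where N: "\<And>m n. m \<ge> N \<Longrightarrow> n \<ge> N \<Longrightarrow> norm (A (e (s m)) - A (e (s n))) < r"
    using CauchyD[OF LIMSEQ_imp_Cauchy[OF l] assms] by blast
  let ?m = "s N" and ?n = "s (Suc N)"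
  have "?m \<noteq> ?n" using s by (simp add: strict_mono_eq)
  then have "(norm (A (e ?m) - A (e ?n)))\<^sup>2 = (\<mu> ?m)\<^sup>2 + (\<mu> ?n)\<^sup>2"
    by (simp add: norm_diff_square images_orthogonal[of ?m ?n] norm_image)
  moreover have "r\<^sup>2 \<le> (\<mu> ?m)\<^sup>2" using large assms by (intro power_mono) auto
  ultimately have "r\<^sup>2 \<le> (norm (A (e ?m) - A (e ?n)))\<^sup>2"
    by (simp add: add_increasing2)
  then have "r \<le> norm (A (e ?m) - A (e ?n))" by (rule power2_le_imp_le) simp
  with N[of N "Suc N"] show False by simp
qed

lemma tendsto_0: "\<mu> \<longlonglongrightarrow> 0"
proof (rule LIMSEQ_I)
  fix r :: real assume "r > 0"
  then obtain N where "\<mu> N < r" using eventually_small by blast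
  then have "norm (\<mu> n - 0) < r" if "n \<ge> N" for n
    using decseqD[OF decseq that] nonneg[of n] by simp
  then show "\<exists>N. \<forall>n\<ge>N. norm (\<mu> n - 0) < r" by blast
qed

end

section \<open>Singular values\<close>

context singular_system
begin

abbreviation root_partial :: "nat \<Rightarrow> 'a \<Rightarrow> 'a" where
  "root_partial N x \<equiv> \<Sum>n<N. (complex_of_real (\<mu> n) * cinner x (e n)) *\<^sub>C e n"

text \<open>The square root of \<open>A\<^sup>*A\<close> acts on the singular vectors by \<open>\<mu>\<close>. By Bessel's inequality the partial
  sums between \<open>N\<close> and \<open>M\<close> are bounded by \<open>\<mu> N \<parallel>x\<parallel>\<close>, so they converge.\<close>

definition root :: "'a \<Rightarrow> 'a" where
  "root x = lim (\<lambda>N. root_partial N x)"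

lemma norm_root_partial_diff:
  assumes "N \<le> M"
  shows "norm (root_partial M x - root_partial N x) \<le> \<mu> N * norm x"
proof -
  have "root_partial M x
      = root_partial N x + (\<Sum>n\<in>{N..<M}. (complex_of_real (\<mu> n) * cinner x (e n)) *\<^sub>C e n)"
    unfolding lessThan_atLeast0 using assms by (intro sum.atLeastLessThan_concat[symmetric]) simp
  moreover have "norm (\<Sum>n\<in>{N..<M}. (complex_of_real (\<mu> n) * cinner x (e n)) *\<^sub>C e n) \<le> \<mu> N * norm x"
    by (rule bessel_weighted) (auto simp: family_on nonneg intro: decseqD[OF decseq])
  ultimately show ?thesis by simp
qed

lemma norm_root_partial: "norm (root_partial N x) \<le> \<mu> 0 * norm x"
  using norm_root_partial_diff[of 0 N x] by simp

lemma root_partial_linear: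
  "root_partial N (x + y) = root_partial N x + root_partial N y"
  "root_partial N (x - y) = root_partial N x - root_partial N y"
  "root_partial N (c *\<^sub>C x) = c *\<^sub>C root_partial N x"
  by (simp_all add: cinner_add_left cinner_diff_left cinner_scaleC_left distrib_left
      right_diff_distrib scaleC_add_left complex_vector.scale_left_diff_distrib sum.distrib
      sum_subtractf complex_vector.scale_sum_right scaleC_scaleC mult_ac)

lemma root_partial_tendsto: "(\<lambda>N. root_partial N x) \<longlonglongrightarrow> root x"
proof -
  have "Cauchy (\<lambda>N. root_partial N x)"
  proof (rule CauchyI)
    fix r :: real assume r: "r > 0"
    have "(\<lambda>N. \<mu> N * norm x) \<longlonglongrightarrow> 0 * norm x" by (intro tendsto_intros tendsto_0)
    then obtain N where N: "\<mu> N * norm x < r"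
      using r order_tendstoD(2)[of "\<lambda>N. \<mu> N * norm x" 0 sequentially r]
      by (auto simp: eventually_sequentially)
    have near: "norm (root_partial m x - root_partial n x) < r" if "N \<le> n" "n \<le> m" for m n
    proof -
      have "norm (root_partial m x - root_partial n x) \<le> \<mu> n * norm x"
        by (rule norm_root_partial_diff[OF that(2)])
      also have "\<dots> \<le> \<mu> N * norm x"
        by (intro mult_right_mono decseqD[OF decseq that(1)]) simp
      finally show ?thesis using N by simp
    qed
    show "\<exists>N. \<forall>m\<ge>N. \<forall>n\<ge>N. norm (root_partial m x - root_partial n x) < r"
    proof (intro exI allI impI)
      fix m n assume "N \<le> m" "N \<le> n"
      then show "norm (root_partial m x - root_partial n x) < r"
        using near[of n m] near[of m n] by (cases "n \<le> m") (simp_all add: norm_minus_commute)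
    qed
  qed
  then show ?thesis unfolding root_def using Cauchy_convergent convergent_LIMSEQ_iff by blast
qed

lemma bounded_clinear_root: "bounded_clinear root"
proof (rule bounded_clinearI[where M = "\<mu> 0"])
  fix x y c
  show "root (x + y) = root x + root y"
    using root_partial_tendsto[of "x + y"]
      tendsto_add[OF root_partial_tendsto[of x] root_partial_tendsto[of y]]
    unfolding root_partial_linear by (rule LIMSEQ_unique)
  show "root (c *\<^sub>C x) = c *\<^sub>C root x"
    using root_partial_tendsto[of "c *\<^sub>C x"]
      tendsto_scaleC[OF tendsto_const root_partial_tendsto[of x]]
    unfolding root_partial_linear by (rule LIMSEQ_unique)
  show "norm (root x) \<le> \<mu> 0 * norm x"
    by (rule LIMSEQ_le_const2[OF tendsto_norm[OF root_partial_tendsto]])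
      (use norm_root_partial in simp)
qed

lemma root_partial_symmetric: "cinner (root_partial N x) y = cinner x (root_partial N y)"
  unfolding cinner_sum_left cinner_sum_right cinner_scaleC_left cinner_scaleC_right
  by (intro sum.cong refl) (simp add: cinner_commute[of y] mult_ac)

lemma root_symmetric: "cinner (root x) y = cinner x (root y)"
proof (rule LIMSEQ_unique)
  show "(\<lambda>N. cinner (root_partial N x) y) \<longlonglongrightarrow> cinner (root x) y"
    by (intro tendsto_cinner root_partial_tendsto tendsto_const)
  show "(\<lambda>N. cinner (root_partial N x) y) \<longlonglongrightarrow> cinner x (root y)"
    unfolding root_partial_symmetric by (intro tendsto_cinner root_partial_tendsto tendsto_const)
qed

lemma positive_operator_root: "positive_operator root"
proof -
  have "Im (cinner (root x) x) = 0" for x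
    using arg_cong[OF cinner_commute[of "root x" x], of Im] by (simp add: root_symmetric)
  moreover have "Re (cinner (root x) x) \<ge> 0" for x
  proof (rule LIMSEQ_le_const)
    show "(\<lambda>N. Re (cinner (root_partial N x) x)) \<longlonglongrightarrow> Re (cinner (root x) x)"
      by (intro tendsto_Re tendsto_cinner root_partial_tendsto tendsto_const)
    have "Re (cinner (root_partial N x) x) = (\<Sum>n<N. \<mu> n * (norm (cinner x (e n)))\<^sup>2)" for N
    proof -
      have "cinner (root_partial N x) x = (\<Sum>n<N. complex_of_real (\<mu> n * (norm (cinner x (e n)))\<^sup>2))"
        unfolding cinner_sum_left cinner_scaleC_left of_real_mult complex_norm_square
        by (intro sum.cong refl) (simp add: cinner_commute[of _ x] mult.assoc)
      then show ?thesis by simp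
    qed
    then show "\<exists>N0. \<forall>N\<ge>N0. 0 \<le> Re (cinner (root_partial N x) x)"
      by (auto intro!: sum_nonneg mult_nonneg_nonneg nonneg)
  qed
  ultimately show ?thesis
    by (simp add: positive_operator_def bounded_clinear_root complex_is_Real_iff
        self_adjointI root_symmetric)
qed

lemma root_partial_square:
  "root_partial N (root_partial N x) = cadjoint A (A (fourier_sum {..<N} e x))"
proof -
  have coeff: "cinner (root_partial N x) (e n) = complex_of_real (\<mu> n) * cinner x (e n)"
    if "n < N" for n
    using cinner_orthogonal_combination[OF finite_lessThan family_on, of n N
        "\<lambda>n. complex_of_real (\<mu> n) * cinner x (e n)"] that zero_or_unit[of n]
    by auto
  have "root_partial N (root_partial N x)
      = (\<Sum>n<N. cinner x (e n) *\<^sub>C complex_of_real ((\<mu> n)\<^sup>2) *\<^sub>C e n)"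
    by (intro sum.cong refl) (simp add: coeff scaleC_scaleC power2_eq_square mult_ac)
  also have "\<dots> = cadjoint A (A (fourier_sum {..<N} e x))"
    unfolding fourier_sum_def
    by (simp only: bounded_clinear_sum[OF bounded_clinear] bounded_clinear_scaleC[OF bounded_clinear]
        bounded_clinear_sum[OF bounded_clinear_cadjoint[OF bounded_clinear]]
        bounded_clinear_scaleC[OF bounded_clinear_cadjoint[OF bounded_clinear]] eigen)
  finally show ?thesis .
qed

text \<open>The Fourier sums of \<open>x\<close> need not converge to \<open>x\<close>, but what they miss is annihilated by \<open>A\<close>
  in the limit.\<close>

lemma image_fourier_sum_tendsto: "(\<lambda>N. A (fourier_sum {..<N} e x)) \<longlonglongrightarrow> A x"
proof -
  have le: "norm (A (x - fourier_sum {..<N} e x)) \<le> \<mu> N * norm x" for N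
  proof -
    have "norm (A (x - fourier_sum {..<N} e x)) \<le> \<mu> N * norm (x - fourier_sum {..<N} e x)"
      by (rule bound) (simp add: fourier_sum_residual family_on)
    also have "\<dots> \<le> \<mu> N * norm x"
      by (intro mult_left_mono norm_residual_le family_on nonneg) simp
    finally show ?thesis .
  qed
  have lim: "(\<lambda>N. \<mu> N * norm x) \<longlonglongrightarrow> 0"
    using tendsto_mult_right[OF tendsto_0, of "norm x"] by simp
  have "(\<lambda>N. A (x - fourier_sum {..<N} e x)) \<longlonglongrightarrow> 0"
    by (rule Lim_null_comparison[OF _ lim]) (simp add: le)
  from tendsto_diff[OF tendsto_const[of "A x"] this] show ?thesis
    by (simp add: bounded_clinear_diff[OF bounded_clinear])
qed

lemma root_square: "root (root x) = cadjoint A (A x)"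
proof (rule LIMSEQ_unique)
  show "(\<lambda>N. root_partial N (root_partial N x)) \<longlonglongrightarrow> cadjoint A (A x)"
    unfolding root_partial_square
    by (rule bounded_clinear_tendsto[OF bounded_clinear_cadjoint[OF bounded_clinear]
          image_fourier_sum_tendsto])
  have "(\<lambda>N. root_partial N x - root x) \<longlonglongrightarrow> 0"
    using root_partial_tendsto[of x] by (simp only: LIM_zero_iff)
  then have lim: "(\<lambda>N. \<mu> 0 * norm (root_partial N x - root x)) \<longlonglongrightarrow> 0"
    by (intro tendsto_mult_right_zero tendsto_norm_zero)
  have "(\<lambda>N. root_partial N (root_partial N x - root x)) \<longlonglongrightarrow> 0"
    by (rule Lim_null_comparison[OF always_eventually lim]) (intro allI norm_root_partial)
  from tendsto_add[OF this root_partial_tendsto[of "root x"]]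
  show "(\<lambda>N. root_partial N (root_partial N x)) \<longlonglongrightarrow> root (root x)"
    unfolding root_partial_linear by simp
qed

lemma abs_operator: "positive_operator (abs_operator A)"
  "abs_operator A (abs_operator A x) = cadjoint A (A x)"
proof -
  have "positive_operator (abs_operator A) \<and> abs_operator A \<circ> abs_operator A = cadjoint A \<circ> A"
    unfolding abs_operator_def
    by (rule someI[of _ root]) (simp add: positive_operator_root fun_eq_iff root_square)
  then show "positive_operator (abs_operator A)"
    "abs_operator A (abs_operator A x) = cadjoint A (A x)"
    by (auto simp: fun_eq_iff)
qed

text \<open>If \<open>P \<ge> 0\<close>, \<open>P\<^sup>2 x = r\<^sup>2 x\<close> and \<open>r > 0\<close>, then \<open>y = P x - r x\<close> satisfies \<open>P y = - r y\<close>, so \<open>y = 0\<close>.\<close>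

lemma eigenspace_abs_operator:
  assumes r: "r > 0"
  shows "eigenspace (abs_operator A) (complex_of_real r)
    = {x. cadjoint A (A x) = complex_of_real (r\<^sup>2) *\<^sub>C x}"
proof -
  let ?P = "abs_operator A"
  have P: "bounded_clinear ?P" and pos: "Re (cinner (?P x) x) \<ge> 0" for x
    using abs_operator(1) by (auto simp: positive_operator_def)
  have "?P x = complex_of_real r *\<^sub>C x \<longleftrightarrow> ?P (?P x) = complex_of_real (r\<^sup>2) *\<^sub>C x" for x
  proof
    assume "?P x = complex_of_real r *\<^sub>C x"
    then show "?P (?P x) = complex_of_real (r\<^sup>2) *\<^sub>C x"
      by (simp add: bounded_clinear_scaleC[OF P] scaleC_scaleC power2_eq_square)
  next
    assume sq: "?P (?P x) = complex_of_real (r\<^sup>2) *\<^sub>C x"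
    define y where "y = ?P x - complex_of_real r *\<^sub>C x"
    have "?P y = complex_of_real (- r) *\<^sub>C y"
      by (simp add: y_def bounded_clinear_diff[OF P] bounded_clinear_scaleC[OF P] sq
          complex_vector.scale_right_diff_distrib scaleC_scaleC power2_eq_square)
    then have "cinner (?P y) y = complex_of_real (- r * (norm y)\<^sup>2)"
      by (simp only: cinner_scaleC_left cinner_self of_real_mult)
    then have "0 \<le> - r * (norm y)\<^sup>2" using pos[of y] by simp
    then have "y = 0" using r by (simp add: mult_le_0_iff)
    then show "?P x = complex_of_real r *\<^sub>C x" by (simp add: y_def)
  qed
  then show ?thesis by (simp add: eigenspace_def abs_operator(2))
qed

lemma finite_multiplicity:
  assumes "r > 0"
  shows "finite {n. \<mu> n = r}"
proof -
  obtain N where "\<mu> N < r" using eventually_small[OF assms] by blast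
  then have "{n. \<mu> n = r} \<subseteq> {..<N}"
    using decseqD[OF decseq, of N] by (auto simp: not_le[symmetric])
  then show ?thesis by (rule finite_subset) simp
qed

text \<open>An eigenvector \<open>y\<close> for \<open>r\<^sup>2\<close> that is orthogonal to the \<open>e n\<close> with \<open>\<mu> n = r\<close> is orthogonal to all
  \<open>e n\<close>, as the others belong to different eigenvalues. Hence
  \<open>r \<parallel>y\<parallel> = \<parallel>A y\<parallel> \<le> \<mu> n \<parallel>y\<parallel>\<close> for all \<open>n\<close>, although \<open>\<mu> n < r\<close> for large \<open>n\<close>,
  so \<open>y = 0\<close>.\<close>

lemma eigenvectors_eq_span:
  assumes r: "r > 0"
  shows "{x. cadjoint A (A x) = complex_of_real (r\<^sup>2) *\<^sub>C x} = cspan (e ` {n. \<mu> n = r})"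
    (is "?E = cspan (e ` ?J)")
proof
  have B: "bounded_clinear (\<lambda>x. cadjoint A (A x))"
    by (intro bounded_clinear_compose[of "cadjoint A" A] bounded_clinear_cadjoint bounded_clinear)
  have sub: "complex_vector.subspace ?E"
    by (auto simp: complex_vector.subspace_def bounded_clinear_zero[OF B] bounded_clinear_add[OF B]
        bounded_clinear_scaleC[OF B] scaleC_add_right scaleC_scaleC mult.commute)
  show span_sub: "cspan (e ` ?J) \<subseteq> ?E"
    by (rule complex_vector.span_minimal[OF _ sub]) (auto simp: eigen)
  have J: "finite ?J" by (rule finite_multiplicity[OF r])
  show "?E \<subseteq> cspan (e ` ?J)"
  proof
    fix x assume x: "x \<in> ?E"
    define y where "y = x - fourier_sum ?J e x"
    have f: "fourier_sum ?J e x \<in> cspan (e ` ?J)"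
      unfolding fourier_sum_def
      by (intro complex_vector.span_sum complex_vector.span_scale complex_vector.span_base) auto
    then have "y \<in> ?E"
      unfolding y_def using x span_sub by (intro complex_vector.subspace_diff[OF sub]) auto
    then have By: "cadjoint A (A y) = complex_of_real (r\<^sup>2) *\<^sub>C y" by simp
    have perp: "cinner y (e n) = 0" for n
    proof (cases "\<mu> n = r")
      case True
      then show ?thesis unfolding y_def by (intro fourier_sum_residual J family_on) simp
    next
      case False
      have "complex_of_real (r\<^sup>2) * cinner y (e n) = cinner (cadjoint A (A y)) (e n)"
        by (simp add: By cinner_scaleC_left)
      also have "\<dots> = cinner y (cadjoint A (A (e n)))"
        by (simp only: cinner_cadjoint_left[OF bounded_clinear] cinner_cadjoint_right[OF bounded_clinear])
      also have "\<dots> = complex_of_real ((\<mu> n)\<^sup>2) * cinner y (e n)"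
        by (simp only: eigen cinner_scaleC_right complex_cnj_complex_of_real)
      finally have "complex_of_real (r\<^sup>2) = complex_of_real ((\<mu> n)\<^sup>2) \<or> cinner y (e n) = 0"
        using mult_right_cancel by blast
      moreover have "r\<^sup>2 \<noteq> (\<mu> n)\<^sup>2"
        using False r nonneg[of n] by (simp add: power2_eq_iff_nonneg)
      ultimately show ?thesis using of_real_eq_iff by blast
    qed
    obtain n where n: "\<mu> n < r" using eventually_small[OF r] by blast
    have "complex_of_real ((norm (A y))\<^sup>2) = complex_of_real ((r * norm y)\<^sup>2)"
      by (simp only: norm_square_eq_cinner[OF bounded_clinear] By cinner_scaleC_left cinner_self
          of_real_mult power_mult_distrib)
    then have "(norm (A y))\<^sup>2 = (r * norm y)\<^sup>2" using of_real_eq_iff by blast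
    then have "r * norm y = norm (A y)" using r by (simp add: power2_eq_iff_nonneg)
    also have "\<dots> \<le> \<mu> n * norm y" by (rule bound) (rule perp)
    finally have "y = 0" using n by (simp add: mult_le_cancel_right)
    then show "x \<in> cspan (e ` ?J)" using f by (simp add: y_def)
  qed
qed

lemma cdim_eigenspace:
  assumes r: "r > 0"
  shows "cdim (eigenspace (abs_operator A) (complex_of_real r)) = card {n. \<mu> n = r}"
proof -
  let ?J = "{n. \<mu> n = r}"
  have unit: "norm (e n) = 1" if "n \<in> ?J" for n using that r norm_vector[of n] by auto
  have inj: "inj_on e ?J"
  proof (rule inj_onI, rule ccontr)
    fix m n assume mn: "m \<in> ?J" "n \<in> ?J" "e m = e n" "m \<noteq> n"
    then have "cinner (e n) (e n) = 0" using orthogonal[of m n] by simp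
    then show False using unit[OF mn(2)] by (simp add: cinner_self)
  qed
  have "\<not> complex_vector.dependent (e ` ?J)"
  proof (rule complex_vector.independent_if_scalars_zero)
    show "finite (e ` ?J)" using finite_multiplicity[OF r] by simp
    fix c v assume zero: "(\<Sum>x\<in>e ` ?J. c x *\<^sub>C x) = 0" and "v \<in> e ` ?J"
    then obtain n where n: "n \<in> ?J" "v = e n" by blast
    have "(\<Sum>i\<in>?J. c (e i) *\<^sub>C e i) = 0" using zero by (simp add: sum.reindex[OF inj])
    then have "c (e n) * complex_of_real ((norm (e n))\<^sup>2) = 0"
      using cinner_orthogonal_combination[OF finite_multiplicity[OF r] family_on n(1), of "\<lambda>i. c (e i)"]
      by simp
    then show "c v = 0" using unit[OF n(1)] n(2) by simp
  qed
  then show ?thesis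
    unfolding eigenspace_abs_operator[OF r] eigenvectors_eq_span[OF r]
    by (subst complex_vector.dim_span_eq_card_independent) (simp_all add: card_image[OF inj])
qed

end

text \<open>A decreasing nonnegative sequence is determined by the multiplicities of its positive values:
  at the first index \<open>n\<close> where two such sequences differ, say with \<open>t n < s n\<close>, the value \<open>s n\<close> is
  taken more often by \<open>s\<close>.\<close>

lemma decseq_determined_by_multiplicities:
  fixes s t :: "nat \<Rightarrow> real"
  assumes s: "decseq s" "\<And>n. s n \<ge> 0" "\<And>r. r > 0 \<Longrightarrow> finite {n. s n = r}"
    and t: "decseq t" "\<And>n. t n \<ge> 0" "\<And>r. r > 0 \<Longrightarrow> finite {n. t n = r}"
    and card: "\<And>r. r > 0 \<Longrightarrow> card {n. s n = r} = card {n. t n = r}"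
  shows "s = t"
proof
  have not_less: "\<not> v n < u n"
    if "decseq v" "\<And>n. v n \<ge> 0" "\<And>r. r > 0 \<Longrightarrow> finite {n. u n = r}"
      "\<And>r. r > 0 \<Longrightarrow> card {n. u n = r} = card {n. v n = r}" "\<And>k. k < n \<Longrightarrow> u k = v k"
    for u v :: "nat \<Rightarrow> real" and n
  proof
    assume less: "v n < u n"
    then have pos: "u n > 0" using that(2)[of n] by linarith
    have "v k \<noteq> u n" if "n \<le> k" for k using decseqD[OF \<open>decseq v\<close> that] less by simp
    then have "k < n" if "v k = u n" for k using that not_less by blast
    then have "{k. v k = u n} \<subset> {k. u k = u n}" using that(5) less by fastforce
    from psubset_card_mono[OF that(3)[OF pos] this] show False using that(4)[OF pos] by simp
  qed
  fix n show "s n = t n"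
  proof (induction n rule: less_induct)
    case (less n)
    have "\<not> t n < s n" by (rule not_less) (use s t card less in auto)
    moreover have "\<not> s n < t n" by (rule not_less) (use s t card less in auto)
    ultimately show ?case by linarith
  qed
qed

lemma (in singular_system) singular_values: "singular_values A = \<mu>"
  unfolding singular_values_def
proof (rule some_equality)
  show "decseq \<mu> \<and> (\<forall>n. \<mu> n \<ge> 0) \<and> (\<forall>r>0. finite {n. \<mu> n = r} \<and>
    card {n. \<mu> n = r} = cdim (eigenspace (abs_operator A) (complex_of_real r)))"
    by (simp add: decseq nonneg finite_multiplicity cdim_eigenspace)
  fix s assume "decseq s \<and> (\<forall>n. s n \<ge> 0) \<and> (\<forall>r>0. finite {n. s n = r} \<and>
    card {n. s n = r} = cdim (eigenspace (abs_operator A) (complex_of_real r)))"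
  then show "s = \<mu>"
    by (intro decseq_determined_by_multiplicities)
      (simp_all add: decseq nonneg finite_multiplicity cdim_eigenspace)
qed

section \<open>Schatten classes as operator ideals\<close>

text \<open>The infimum of these \<open>\<epsilon>\<close> is the \<open>n\<close>-th Gelfand number of \<open>A\<close>. Since only the existence of bounds
  matters for summability, the infimum itself is never formed.\<close>

definition gelfand_bound :: "('a::complex_inner_space \<Rightarrow> 'a) \<Rightarrow> nat \<Rightarrow> real \<Rightarrow> bool" where
  "gelfand_bound A n \<epsilon> \<longleftrightarrow> 0 \<le> \<epsilon> \<and> (\<exists>F. finite F \<and> card F \<le> n \<and>
     (\<forall>x\<in>orthogonal_complement F. norm (A x) \<le> \<epsilon> * norm x))"

lemma (in singular_system) gelfand_bound: "gelfand_bound A n (\<mu> n)"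
proof -
  have "card (e ` {..<n}) \<le> n" using card_image_le[of "{..<n}" e] by simp
  then show ?thesis
    unfolding gelfand_bound_def
    by (intro conjI nonneg exI[of _ "e ` {..<n}"] ballI bound) (auto simp: orthogonal_complement_def)
qed

text \<open>The minimax principle: \<open>n\<close> linear conditions leave a nonzero vector in the span of the first
  \<open>n + 1\<close> singular vectors, and \<open>\<parallel>A x\<parallel> \<ge> \<mu> n \<parallel>x\<parallel>\<close> on that span.\<close>

lemma (in singular_system) gelfand_bound_ge:
  assumes "gelfand_bound A n \<epsilon>"
  shows "\<mu> n \<le> \<epsilon>"
proof (cases "\<mu> n = 0")
  case False
  obtain F where F: "finite F" "card F \<le> n"
    and le: "\<And>x. x \<in> orthogonal_complement F \<Longrightarrow> norm (A x) \<le> \<epsilon> * norm x"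
    using assms by (auto simp: gelfand_bound_def)
  obtain a where a: "\<exists>i\<in>{..n}. a i \<noteq> 0" and sol: "\<forall>f\<in>F. (\<Sum>i\<le>n. a i * cinner (e i) f) = 0"
    using homogeneous_system_solution[OF F(1), of "{..n}" "\<lambda>i f. cinner (e i) f"] F(2) by auto
  define x where "x = (\<Sum>i\<le>n. a i *\<^sub>C e i)"
  have large: "\<mu> n \<le> \<mu> i" if "i \<le> n" for i by (rule decseqD[OF decseq that])
  have unit: "norm (e i) = 1" if "i \<le> n" for i
    using large[OF that] nonneg[of n] False by (intro norm_vector) auto
  have "x \<in> orthogonal_complement F"
    using sol by (simp add: x_def orthogonal_complement_def cinner_sum_left cinner_scaleC_left)
  note upper = le[OF this]
  have norm_x: "(norm x)\<^sup>2 = (\<Sum>i\<le>n. (norm (a i))\<^sup>2)"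
    unfolding x_def norm_orthogonal_combination[OF finite_atMost family_on]
    by (intro sum.cong) (auto simp: unit)
  have "(norm (A x))\<^sup>2 = (\<Sum>i\<le>n. (norm (a i *\<^sub>C A (e i)))\<^sup>2)"
    unfolding x_def bounded_clinear_sum[OF bounded_clinear] bounded_clinear_scaleC[OF bounded_clinear]
    by (rule norm_sum_orthogonal)
      (auto simp: cinner_scaleC_left cinner_scaleC_right images_orthogonal)
  also have "\<dots> = (\<Sum>i\<le>n. (norm (a i))\<^sup>2 * (\<mu> i)\<^sup>2)"
    by (simp add: norm_scaleC norm_image power_mult_distrib)
  also have "\<dots> \<ge> (\<Sum>i\<le>n. (norm (a i))\<^sup>2 * (\<mu> n)\<^sup>2)"
    by (intro sum_mono mult_left_mono power_mono large nonneg) auto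
  also have "(\<Sum>i\<le>n. (norm (a i))\<^sup>2 * (\<mu> n)\<^sup>2) = (\<mu> n * norm x)\<^sup>2"
    by (simp add: norm_x power_mult_distrib sum_distrib_left mult.commute)
  finally have "\<mu> n * norm x \<le> norm (A x)" by (rule power2_le_imp_le) simp
  with upper have "\<mu> n * norm x \<le> \<epsilon> * norm x" by simp
  moreover have "norm x \<noteq> 0"
  proof
    assume "norm x = 0"
    then have "(\<Sum>i\<le>n. (norm (a i))\<^sup>2) = 0" using norm_x by simp
    then show False using a by (simp add: sum_nonneg_eq_0_iff)
  qed
  ultimately show ?thesis by (simp add: mult_le_cancel_right)
qed (use assms in \<open>auto simp: gelfand_bound_def\<close>)

text \<open>Any summable sequence of bounds will do, not only the least ones. This is the form in which
  membership is inherited by sums, products and adjoints.\<close>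

theorem schatten_class_iff_gelfand_bound:
  fixes A :: "'a::complex_hilbert_space \<Rightarrow> 'a"
  assumes "p \<ge> 0"
  shows "A \<in> schatten_class p \<longleftrightarrow>
    compact_operator A \<and> (\<exists>\<epsilon>. (\<forall>n. gelfand_bound A n (\<epsilon> n)) \<and> summable (\<lambda>n. \<epsilon> n powr p))"
proof (cases "compact_operator A")
  case True
  then obtain e \<mu> where "singular_system A e \<mu>" using singular_system_exists by blast
  then interpret singular_system A e \<mu> .
  have "summable (\<lambda>n. \<mu> n powr p)"
    if "\<And>n. gelfand_bound A n (\<epsilon> n)" "summable (\<lambda>n. \<epsilon> n powr p)" for \<epsilon>
    using gelfand_bound_ge[OF that(1)] nonneg assms
    by (intro summable_comparison_test'[OF that(2), of 0]) (auto intro!: powr_mono2)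
  then show ?thesis
    using True gelfand_bound by (auto simp: schatten_class_def singular_values)
qed (simp add: schatten_class_def)

lemma gelfand_boundE:
  assumes "gelfand_bound A n \<epsilon>"
  obtains F where "finite F" "card F \<le> n"
    "\<And>x. x \<in> orthogonal_complement F \<Longrightarrow> norm (A x) \<le> \<epsilon> * norm x"
  using assms by (auto simp: gelfand_bound_def)

lemma gelfand_boundI:
  assumes "0 \<le> \<epsilon>" "finite F" "card F \<le> n"
    and "\<And>x. x \<in> orthogonal_complement F \<Longrightarrow> norm (A x) \<le> \<epsilon> * norm x"
  shows "gelfand_bound A n \<epsilon>"
  using assms by (auto simp: gelfand_bound_def)

lemma gelfand_bound_nonneg: "gelfand_bound A n \<epsilon> \<Longrightarrow> 0 \<le> \<epsilon>"
  by (simp add: gelfand_bound_def)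

lemma gelfand_bound_plus:
  assumes A: "gelfand_bound A m a" and B: "gelfand_bound B n b" and k: "m + n \<le> k"
  shows "gelfand_bound (\<lambda>x. A x + B x) k (a + b)"
proof -
  obtain F where F: "finite F" "card F \<le> m"
    "\<And>x. x \<in> orthogonal_complement F \<Longrightarrow> norm (A x) \<le> a * norm x"
    using gelfand_boundE[OF A] by blast
  obtain G where G: "finite G" "card G \<le> n"
    "\<And>x. x \<in> orthogonal_complement G \<Longrightarrow> norm (B x) \<le> b * norm x"
    using gelfand_boundE[OF B] by blast
  show ?thesis
  proof (rule gelfand_boundI)
    show "card (F \<union> G) \<le> k" using card_Un_le[of F G] F(2) G(2) k by linarith
    fix x assume "x \<in> orthogonal_complement (F \<union> G)"
    then have "x \<in> orthogonal_complement F" "x \<in> orthogonal_complement G"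
      by (auto simp: orthogonal_complement_def)
    then show "norm (A x + B x) \<le> (a + b) * norm x"
      using F(3)[of x] G(3)[of x] norm_triangle_ineq[of "A x" "B x"]
      by (simp add: distrib_right)
  qed (use F(1) G(1) gelfand_bound_nonneg[OF A] gelfand_bound_nonneg[OF B] in auto)
qed

lemma gelfand_bound_compose_left:
  assumes A: "gelfand_bound A n a" and B: "M \<ge> 0" "\<And>x. norm (B x) \<le> M * norm x"
  shows "gelfand_bound (\<lambda>x. B (A x)) n (M * a)"
proof -
  obtain F where F: "finite F" "card F \<le> n"
    "\<And>x. x \<in> orthogonal_complement F \<Longrightarrow> norm (A x) \<le> a * norm x"
    using gelfand_boundE[OF A] by blast
  show ?thesis
  proof (rule gelfand_boundI[OF _ F(1,2)])
    fix x assume x: "x \<in> orthogonal_complement F"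
    have "norm (B (A x)) \<le> M * norm (A x)" by (rule B(2))
    also have "\<dots> \<le> M * (a * norm x)" by (rule mult_left_mono[OF F(3)[OF x] B(1)])
    finally show "norm (B (A x)) \<le> M * a * norm x" by (simp add: mult.assoc)
  qed (use B(1) gelfand_bound_nonneg[OF A] in simp)
qed

lemma gelfand_bound_compose_right:
  fixes A B :: "'a::complex_hilbert_space \<Rightarrow> 'a"
  assumes A: "gelfand_bound A n a" and B: "bounded_clinear B"
    and M: "M \<ge> 0" "\<And>x. norm (B x) \<le> M * norm x"
  shows "gelfand_bound (\<lambda>x. A (B x)) n (M * a)"
proof -
  obtain F where F: "finite F" "card F \<le> n"
    "\<And>x. x \<in> orthogonal_complement F \<Longrightarrow> norm (A x) \<le> a * norm x"
    using gelfand_boundE[OF A] by blast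
  show ?thesis
  proof (rule gelfand_boundI)
    show "finite (cadjoint B ` F)" using F(1) by simp
    show "card (cadjoint B ` F) \<le> n" using card_image_le[OF F(1), of "cadjoint B"] F(2) by simp
    fix x assume "x \<in> orthogonal_complement (cadjoint B ` F)"
    then have "B x \<in> orthogonal_complement F"
      by (simp add: orthogonal_complement_def cinner_cadjoint_right[OF B])
    then have "norm (A (B x)) \<le> a * norm (B x)" by (rule F(3))
    also have "\<dots> \<le> a * (M * norm x)"
      by (rule mult_left_mono[OF M(2) gelfand_bound_nonneg[OF A]])
    finally show "norm (A (B x)) \<le> M * a * norm x" by (simp add: mult_ac)
  qed (use M(1) gelfand_bound_nonneg[OF A] in simp)
qed

text \<open>If \<open>x\<close> is orthogonal to \<open>A F\<close>, then \<open>A\<^sup>*x\<close> is orthogonal to \<open>F\<close>, so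
  \<open>\<parallel>A\<^sup>*x\<parallel>\<^sup>2 = \<langle>x, A A\<^sup>*x\<rangle> \<le> \<parallel>x\<parallel> a \<parallel>A\<^sup>*x\<parallel>\<close>.\<close>

lemma gelfand_bound_cadjoint:
  fixes A :: "'a::complex_hilbert_space \<Rightarrow> 'a"
  assumes A: "bounded_clinear A" and bnd: "gelfand_bound A n a"
  shows "gelfand_bound (cadjoint A) n a"
proof -
  obtain F where F: "finite F" "card F \<le> n"
    "\<And>x. x \<in> orthogonal_complement F \<Longrightarrow> norm (A x) \<le> a * norm x"
    using gelfand_boundE[OF bnd] by blast
  show ?thesis
  proof (rule gelfand_boundI)
    show "finite (A ` F)" using F(1) by simp
    show "card (A ` F) \<le> n" using card_image_le[OF F(1), of A] F(2) by simp
    fix x assume x: "x \<in> orthogonal_complement (A ` F)"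
    let ?y = "cadjoint A x"
    have "?y \<in> orthogonal_complement F"
      using x by (simp add: orthogonal_complement_def cinner_cadjoint_left[OF A])
    then have Ay: "norm (A ?y) \<le> a * norm ?y" by (rule F(3))
    have "(norm ?y)\<^sup>2 = norm (cinner x (A ?y))"
      by (simp add: cinner_cadjoint_left[OF A, symmetric] cinner_self norm_power)
    also have "\<dots> \<le> norm x * (a * norm ?y)"
      by (rule order_trans[OF norm_cinner_le mult_left_mono[OF Ay norm_ge_zero]])
    finally have "norm ?y * norm ?y \<le> norm ?y * (a * norm x)"
      by (simp add: power2_eq_square mult_ac)
    then show "norm ?y \<le> a * norm x"
      using gelfand_bound_nonneg[OF bnd] by (cases "norm ?y = 0") auto
  qed (rule gelfand_bound_nonneg[OF bnd])
qed

lemma summable_div_2: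
  fixes f :: "nat \<Rightarrow> real"
  assumes f: "summable f" "\<And>n. 0 \<le> f n"
  shows "summable (\<lambda>n. f (n div 2))"
proof (rule summableI_nonneg_bounded)
  fix n
  have double: "(\<Sum>k<2 * n. f (k div 2)) = 2 * (\<Sum>k<n. f k)" for n
    by (induction n) simp_all
  have "(\<Sum>k<n. f (k div 2)) \<le> (\<Sum>k<2 * n. f (k div 2))"
    using f(2) by (intro sum_mono2) auto
  also have "\<dots> \<le> 2 * suminf f"
    unfolding double using sum_le_suminf[OF f(1), of "{..<n}"] f(2) by simp
  finally show "(\<Sum>k<n. f (k div 2)) \<le> 2 * suminf f" .
qed (rule f(2))

lemma powr_add_le:
  fixes a b :: real
  assumes "0 \<le> a" "0 \<le> b" "0 \<le> p"
  shows "(a + b) powr p \<le> 2 powr p * (a powr p + b powr p)"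
proof -
  have "(a + b) powr p \<le> (2 * max a b) powr p"
    using assms by (intro powr_mono2) auto
  also have "\<dots> = 2 powr p * (max a b) powr p" using assms by (simp add: powr_mult)
  also have "\<dots> \<le> 2 powr p * (a powr p + b powr p)"
    by (intro mult_left_mono) (auto simp: max_def)
  finally show ?thesis .
qed

context
  fixes p :: real
  assumes p: "0 \<le> p"
begin

lemma schatten_classE:
  fixes A :: "'a::complex_hilbert_space \<Rightarrow> 'a"
  assumes "A \<in> schatten_class p"
  obtains \<epsilon> where "compact_operator A" "bounded_clinear A" "\<forall>n. gelfand_bound A n (\<epsilon> n)"
    "summable (\<lambda>n. \<epsilon> n powr p)"
  using assms compact_operator_imp_bounded_clinear
  unfolding schatten_class_iff_gelfand_bound[OF p] by blast

text \<open>The bounds for \<open>A\<close> and \<open>B\<close> with index \<open>n div 2\<close> involve at most \<open>n\<close> vectors together; repeating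
  each term twice does not affect summability.\<close>

lemma schatten_class_plus:
  fixes A B :: "'a::complex_hilbert_space \<Rightarrow> 'a"
  assumes A: "A \<in> schatten_class p" and B: "B \<in> schatten_class p"
  shows "(\<lambda>x. A x + B x) \<in> schatten_class p"
proof -
  obtain a where a: "compact_operator A" "bounded_clinear A"
      "\<forall>n. gelfand_bound A n (a n)" "summable (\<lambda>n. a n powr p)"
    using A by (rule schatten_classE)
  note a_bound = a(3)[rule_format]
  obtain b where b: "compact_operator B" "bounded_clinear B"
      "\<forall>n. gelfand_bound B n (b n)" "summable (\<lambda>n. b n powr p)"
    using B by (rule schatten_classE)
  note b_bound = b(3)[rule_format]
  define \<epsilon> where "\<epsilon> n = a (n div 2) + b (n div 2)" for n
  have "gelfand_bound (\<lambda>x. A x + B x) n (\<epsilon> n)" for n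
    unfolding \<epsilon>_def by (rule gelfand_bound_plus[OF a_bound b_bound]) simp
  moreover have "summable (\<lambda>n. \<epsilon> n powr p)"
  proof (rule summable_comparison_test')
    show "summable (\<lambda>n. 2 powr p * (a (n div 2) powr p + b (n div 2) powr p))"
      using summable_div_2[OF a(4)] summable_div_2[OF b(4)]
      by (intro summable_mult summable_add) auto
    show "norm (\<epsilon> n powr p) \<le> 2 powr p * (a (n div 2) powr p + b (n div 2) powr p)" for n
      using powr_add_le[OF gelfand_bound_nonneg[OF a_bound] gelfand_bound_nonneg[OF b_bound] p]
      by (simp add: \<epsilon>_def)
  qed
  ultimately show ?thesis
    unfolding schatten_class_iff_gelfand_bound[OF p]
    using compact_operator_plus[OF a(1) b(1)] by blast
qed

lemma summable_powr_scaled: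
  assumes "summable (\<lambda>n. a n powr p)" "\<And>n. 0 \<le> a n" "0 \<le> M"
  shows "summable (\<lambda>n. (M * a n) powr p)"
  using summable_mult[OF assms(1), of "M powr p"] assms(2,3) by (simp add: powr_mult)

lemma schatten_class_compose_left:
  fixes A B :: "'a::complex_hilbert_space \<Rightarrow> 'a"
  assumes B: "bounded_clinear B" and A: "A \<in> schatten_class p"
  shows "(\<lambda>x. B (A x)) \<in> schatten_class p"
proof -
  obtain a where a: "compact_operator A" "bounded_clinear A"
      "\<forall>n. gelfand_bound A n (a n)" "summable (\<lambda>n. a n powr p)"
    using A by (rule schatten_classE)
  note a_bound = a(3)[rule_format]
  obtain M where M: "M > 0" "\<And>x. norm (B x) \<le> M * norm x" using bounded_clinear_bound[OF B] by blast
  have "gelfand_bound (\<lambda>x. B (A x)) n (M * a n)" for n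
    by (rule gelfand_bound_compose_left[OF a_bound less_imp_le[OF M(1)] M(2)])
  then show ?thesis
    unfolding schatten_class_iff_gelfand_bound[OF p]
    using compact_operator_compose_left[OF B a(1)]
      summable_powr_scaled[OF a(4) gelfand_bound_nonneg[OF a_bound] less_imp_le[OF M(1)]]
    by (intro conjI exI[of _ "\<lambda>n. M * a n"]) simp_all
qed

lemma schatten_class_compose_right:
  fixes A B :: "'a::complex_hilbert_space \<Rightarrow> 'a"
  assumes A: "A \<in> schatten_class p" and B: "bounded_clinear B"
  shows "(\<lambda>x. A (B x)) \<in> schatten_class p"
proof -
  obtain a where a: "compact_operator A" "bounded_clinear A"
      "\<forall>n. gelfand_bound A n (a n)" "summable (\<lambda>n. a n powr p)"
    using A by (rule schatten_classE)
  note a_bound = a(3)[rule_format]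
  obtain M where M: "M > 0" "\<And>x. norm (B x) \<le> M * norm x" using bounded_clinear_bound[OF B] by blast
  have "gelfand_bound (\<lambda>x. A (B x)) n (M * a n)" for n
    by (rule gelfand_bound_compose_right[OF a_bound B less_imp_le[OF M(1)] M(2)])
  then show ?thesis
    unfolding schatten_class_iff_gelfand_bound[OF p]
    using compact_operator_compose_right[OF a(1) B]
      summable_powr_scaled[OF a(4) gelfand_bound_nonneg[OF a_bound] less_imp_le[OF M(1)]]
    by (intro conjI exI[of _ "\<lambda>n. M * a n"]) simp_all
qed

lemma schatten_class_scaleC:
  fixes A :: "'a::complex_hilbert_space \<Rightarrow> 'a"
  assumes "A \<in> schatten_class p"
  shows "(\<lambda>x. c *\<^sub>C A x) \<in> schatten_class p"
  by (rule schatten_class_compose_left[OF bounded_clinear_scaleC_ident assms])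

lemma schatten_class_minus:
  fixes A B :: "'a::complex_hilbert_space \<Rightarrow> 'a"
  assumes A: "A \<in> schatten_class p" and B: "B \<in> schatten_class p"
  shows "(\<lambda>x. A x - B x) \<in> schatten_class p"
  using schatten_class_plus[OF A schatten_class_scaleC[OF B, of "-1"]] by simp

lemma schatten_class_cadjoint:
  fixes A :: "'a::complex_hilbert_space \<Rightarrow> 'a"
  assumes A: "A \<in> schatten_class p"
  shows "cadjoint A \<in> schatten_class p"
proof -
  obtain a where a: "compact_operator A" "bounded_clinear A" "\<forall>n. gelfand_bound A n (a n)"
    "summable (\<lambda>n. a n powr p)"
    using A by (rule schatten_classE)
  then show ?thesis
    unfolding schatten_class_iff_gelfand_bound[OF p]
    using compact_operator_cadjoint[OF a(1)] gelfand_bound_cadjoint[OF a(2)] by blast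
qed

lemma orthogonal_projection_finite_dimensional:
  fixes N :: "'a::complex_hilbert_space set"
  assumes fin: "finite_dimensional N" and closed: "closed N"
  shows "orthogonal_projection N \<in> schatten_class p"
proof -
  obtain B where B: "finite B" "cspan B = N" using fin by (auto simp: finite_dimensional_def)
  obtain E where E: "finite E" "orthonormal_or_zero E (\<lambda>x. x)" and span: "cspan E = N"
    using gram_schmidt[OF B(1)] B(2) by auto
  have sub: "complex_vector.subspace N" unfolding span[symmetric] by (rule complex_vector.subspace_span)
  have P: "orthogonal_projection N = fourier_sum E (\<lambda>x. x)"
  proof
    fix x
    show "orthogonal_projection N x = fourier_sum E (\<lambda>x. x) x"
    proof (rule orthogonal_projection_unique[OF closed sub])
      show "fourier_sum E (\<lambda>x. x) x \<in> N"
        unfolding fourier_sum_def span[symmetric]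
        by (intro complex_vector.span_sum complex_vector.span_scale complex_vector.span_base)
      let ?S = "{y. cinner (x - fourier_sum E (\<lambda>x. x) x) y = 0}"
      have "complex_vector.subspace ?S"
        by (auto simp: complex_vector.subspace_def cinner_add_right cinner_scaleC_right)
      then have "cspan E \<subseteq> ?S"
        by (intro complex_vector.span_minimal) (auto intro: fourier_sum_residual[OF E])
      then show "x - fourier_sum E (\<lambda>x. x) x \<in> orthogonal_complement N"
        by (auto simp: orthogonal_complement_def span)
    qed
  qed
  have "compact_operator (orthogonal_projection N)"
    using compact_operator_finite_rank[OF E(1), of "\<lambda>x. x" "\<lambda>x. x"]
    by (simp add: P fourier_sum_def[abs_def])
  moreover have "gelfand_bound (orthogonal_projection N) n (if n < card E then 1 else 0)" for n
  proof (cases "n < card E")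
    case True
    have "norm (fourier_sum E (\<lambda>x. x) x) \<le> norm x" for x
      by (rule power2_le_imp_le) (use norm_fourier_sum_residual[OF E, of x] in auto)
    then show ?thesis using True by (intro gelfand_boundI[of _ "{}"]) (auto simp: P)
  next
    case False
    have "fourier_sum E (\<lambda>x. x) x = 0" if "x \<in> orthogonal_complement E" for x
      using that by (simp add: fourier_sum_def orthogonal_complement_def)
    then show ?thesis using False by (intro gelfand_boundI[of _ E] E(1)) (auto simp: P)
  qed
  moreover have "summable (\<lambda>n. (if n < card E then 1 else 0 :: real) powr p)"
    by (rule summable_finite[of "{..<card E}"]) auto
  ultimately show ?thesis
    unfolding schatten_class_iff_gelfand_bound[OF p]
    by (intro conjI exI[of _ "\<lambda>n. if n < card E then 1 else 0"]) simp_all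
qed

end

section \<open>Partial isometries\<close>

lemma norm_diff_orthogonal_projection:
  fixes M :: "'a::complex_hilbert_space set"
  assumes M: "closed M" "complex_vector.subspace M"
  shows "norm (x - orthogonal_projection M x) \<le> norm x"
proof -
  have "cinner (x - orthogonal_projection M x) (orthogonal_projection M x) = 0"
    using orthogonal_projection_in[OF M] orthogonal_projection_diff[OF M]
    by (auto simp: orthogonal_complement_def)
  from norm_add_orthogonal[OF this] have "(norm (x - orthogonal_projection M x))\<^sup>2 \<le> (norm x)\<^sup>2"
    by simp
  then show ?thesis by (rule power2_le_imp_le) simp
qed

text \<open>On the initial space, \<open>\<parallel>V\<^sup>*V x - x\<parallel>\<^sup>2 = \<parallel>V\<^sup>*V x\<parallel>\<^sup>2 - 2 \<parallel>V x\<parallel>\<^sup>2 + \<parallel>x\<parallel>\<^sup>2 \<le> 0\<close>, because \<open>V\<^sup>*\<close> is a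
  contraction.\<close>

lemma partial_isometry_cadjoint_self:
  fixes V :: "'a::complex_hilbert_space \<Rightarrow> 'a"
  assumes iso: "partial_isometry V"
  shows "cadjoint V (V x) = x - orthogonal_projection (null_space V) x"
proof -
  let ?P = "orthogonal_projection (null_space V)"
  have V: "bounded_clinear V" using iso by (simp add: partial_isometry_def)
  note N = closed_null_space[OF V] subspace_null_space[OF V]
  have isometric: "norm (V (x - ?P x)) = norm (x - ?P x)" for x
    using iso orthogonal_projection_diff[OF N, of x]
    by (simp add: partial_isometry_def orthogonal_complement_def)
  have V_diff: "V (x - ?P x) = V x" for x
    using orthogonal_projection_in[OF N, of x] by (simp add: bounded_clinear_diff[OF V] null_space_def)
  have contraction: "norm (V x) \<le> norm x" for x
    using norm_diff_orthogonal_projection[OF N, of x] isometric[of x] by (simp add: V_diff)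
  have contraction': "norm (cadjoint V x) \<le> norm x" for x
  proof -
    have "(norm (cadjoint V x))\<^sup>2 = norm (cinner (V (cadjoint V x)) x)"
      by (simp add: cinner_cadjoint_right[OF V] cinner_self norm_power)
    also have "\<dots> \<le> norm (cadjoint V x) * norm x"
      by (rule order_trans[OF norm_cinner_le mult_right_mono[OF contraction norm_ge_zero]])
    finally show ?thesis by (cases "norm (cadjoint V x) = 0") (auto simp: power2_eq_square)
  qed
  define u where "u = x - ?P x"
  have "Re (cinner (cadjoint V (V u)) u) = (norm (V u))\<^sup>2"
    by (simp add: cinner_cadjoint_left[OF V] cinner_self)
  moreover have "norm (V u) = norm u" unfolding u_def by (rule isometric)
  moreover have "(norm (cadjoint V (V u)))\<^sup>2 \<le> (norm (V u))\<^sup>2"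
    by (rule power_mono[OF contraction' norm_ge_zero])
  ultimately have "(norm (cadjoint V (V u) - u))\<^sup>2 \<le> 0"
    unfolding norm_diff_square by simp
  then have "cadjoint V (V u) = u" by simp
  then show ?thesis by (simp add: u_def V_diff)
qed

section \<open>Moore--Penrose inverses\<close>

lemma moore_penrose_unique:
  fixes T X Y :: "'a::complex_hilbert_space \<Rightarrow> 'a"
  assumes T: "bounded_clinear T"
    and X: "bounded_clinear X" "self_adjoint (T \<circ> X)" "self_adjoint (X \<circ> T)" "T \<circ> X \<circ> T = T" "X \<circ> T \<circ> X = X"
    and Y: "bounded_clinear Y" "self_adjoint (T \<circ> Y)" "self_adjoint (Y \<circ> T)" "T \<circ> Y \<circ> T = T" "Y \<circ> T \<circ> Y = Y"
  shows "X = Y"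
proof -
  have TXT: "T (X (T x)) = T x" "T (Y (T x)) = T x" for x
    using X(4) Y(4) by (metis comp_apply)+
  have XTX: "X (T (X x)) = X x" "Y (T (Y x)) = Y x" for x
    using X(5) Y(5) by (metis comp_apply)+
  have bcl: "bounded_clinear (T \<circ> X)" "bounded_clinear (T \<circ> Y)" "bounded_clinear (X \<circ> T)" "bounded_clinear (Y \<circ> T)"
    using bounded_clinear_compose[OF T X(1)] bounded_clinear_compose[OF T Y(1)]
      bounded_clinear_compose[OF X(1) T] bounded_clinear_compose[OF Y(1) T] by (simp_all add: o_def)
  note TX_sym = self_adjoint_cinner[OF bcl(1) X(2), unfolded comp_apply]
    and TY_sym = self_adjoint_cinner[OF bcl(2) Y(2), unfolded comp_apply]
    and XT_sym = self_adjoint_cinner[OF bcl(3) X(3), unfolded comp_apply]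
    and YT_sym = self_adjoint_cinner[OF bcl(4) Y(3), unfolded comp_apply]
  \<comment> \<open>\<open>T X\<close> and \<open>T Y\<close> are orthogonal projections with the same range.\<close>
  have "T \<circ> X = T \<circ> Y"
  proof (intro ext cinner_eq_all_imp_eq)
    fix x y
    have "cinner (T (X x)) y = cinner (T (Y (T (X x)))) y" by (simp only: TXT)
    also have "\<dots> = cinner x (T (X (T (Y y))))" by (simp only: TX_sym TY_sym)
    also have "\<dots> = cinner (T (Y x)) y" by (simp only: TXT TY_sym)
    finally show "cinner ((T \<circ> X) x) y = cinner ((T \<circ> Y) x) y" by simp
  qed
  \<comment> \<open>\<open>X T\<close> and \<open>Y T\<close> are orthogonal projections with the same null space.\<close>
  moreover have "X \<circ> T = Y \<circ> T"
  proof (intro ext cinner_eq_all_imp_eq)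
    fix x y
    have "cinner (X (T x)) y = cinner (X (T (Y (T x)))) y" by (simp only: TXT)
    also have "\<dots> = cinner x (Y (T (X (T y))))" by (simp only: XT_sym YT_sym)
    also have "\<dots> = cinner (Y (T x)) y" by (simp only: TXT YT_sym)
    finally show "cinner ((X \<circ> T) x) y = cinner ((Y \<circ> T) x) y" by simp
  qed
  ultimately have "X x = Y x" for x
    by (metis XTX comp_apply)
  then show ?thesis by blast
qed

text \<open>The inverse maps \<open>y\<close> to the least-squares solution of minimal norm: \<open>y\<close> is projected to the
  closed range of \<open>T\<close>, and of the preimages the one orthogonal to the null space is taken.\<close>

lemma moore_penrose_exists:
  fixes T :: "'a::complex_hilbert_space \<Rightarrow> 'a"
  assumes T: "bounded_clinear T" and range: "closed (range T)" and c: "c > 0"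
    and below: "\<forall>x\<in>orthogonal_complement (null_space T). c * norm x \<le> norm (T x)"
  shows "\<exists>X. bounded_clinear X \<and> self_adjoint (T \<circ> X) \<and> self_adjoint (X \<circ> T) \<and>
    T \<circ> X \<circ> T = T \<and> X \<circ> T \<circ> X = X"
proof -
  let ?H = "orthogonal_complement (null_space T)"
  let ?P = "orthogonal_projection (null_space T)" and ?Q = "orthogonal_projection (range T)"
  note N = closed_null_space[OF T] subspace_null_space[OF T]
  have sub: "complex_vector.subspace (range T)"
    unfolding complex_vector.subspace_def
  proof (intro conjI ballI allI)
    show "0 \<in> range T" using bounded_clinear_zero[OF T] by (rule range_eqI[OF sym])
    fix x y c assume "x \<in> range T"
    then obtain u where x: "x = T u" by blast
    show "c *\<^sub>C x \<in> range T"
      by (rule range_eqI[of _ _ "c *\<^sub>C u"]) (simp add: x bounded_clinear_scaleC[OF T])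
    assume "y \<in> range T"
    then obtain v where y: "y = T v" by blast
    show "x + y \<in> range T"
      by (rule range_eqI[of _ _ "u + v"]) (simp add: x y bounded_clinear_add[OF T])
  qed
  note R = range sub
  note H = subspace_orthogonal_complement[of "null_space T"]
  have T_diff: "T (x - ?P x) = T x" for x
    using orthogonal_projection_in[OF N, of x] by (simp add: bounded_clinear_diff[OF T] null_space_def)
  have "\<exists>u\<in>?H. T u = ?Q y" for y
  proof -
    obtain x where "?Q y = T x" using orthogonal_projection_in[OF R, of y] by (rule rangeE)
    then show ?thesis
      by (intro bexI[of _ "x - ?P x"] orthogonal_projection_diff[OF N]) (simp add: T_diff)
  qed
  then obtain X where X_H: "\<And>y. X y \<in> ?H" and TX: "\<And>y. T (X y) = ?Q y" by metis
  have inj: "u = v" if "u \<in> ?H" "v \<in> ?H" "T u = T v" for u v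
  proof -
    have "c * norm (u - v) \<le> 0"
      using bspec[OF below complex_vector.subspace_diff[OF H that(1,2)]] that(3)
      by (simp add: bounded_clinear_diff[OF T])
    then show ?thesis using c by (simp add: mult_le_0_iff)
  qed
  have Q: "bounded_clinear ?Q" by (rule bounded_clinear_orthogonal_projection[OF R])
  obtain M where M: "M > 0" "\<And>x. norm (?Q x) \<le> M * norm x" using bounded_clinear_bound[OF Q] by blast
  have X: "bounded_clinear X"
  proof (rule bounded_clinearI[where M = "M / c"])
    fix x y d
    show "X (x + y) = X x + X y"
      by (rule inj[OF X_H complex_vector.subspace_add[OF H X_H X_H]])
        (simp add: TX bounded_clinear_add[OF T] bounded_clinear_add[OF Q])
    show "X (d *\<^sub>C x) = d *\<^sub>C X x"
      by (rule inj[OF X_H complex_vector.subspace_scale[OF H X_H]])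
        (simp add: TX bounded_clinear_scaleC[OF T] bounded_clinear_scaleC[OF Q])
    have "c * norm (X x) \<le> M * norm x"
      using bspec[OF below X_H[of x]] M(2)[of x] by (simp add: TX)
    then show "norm (X x) \<le> M / c * norm x" using c by (simp add: field_simps)
  qed
  have XT: "X (T x) = x - ?P x" for x
    by (rule inj[OF X_H orthogonal_projection_diff[OF N]])
      (simp add: TX T_diff orthogonal_projection_fixes[OF R])
  have "self_adjoint (T \<circ> X)"
    by (rule self_adjointI) (simp add: TX cinner_orthogonal_projection[OF R])
  moreover have "self_adjoint (X \<circ> T)"
    by (rule self_adjointI)
      (simp add: XT cinner_diff_left cinner_diff_right cinner_orthogonal_projection[OF N])
  moreover have "T \<circ> X \<circ> T = T" by (simp add: fun_eq_iff XT T_diff)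
  moreover have "X \<circ> T \<circ> X = X"
    by (simp add: fun_eq_iff XT orthogonal_projection_eq_0[OF N X_H])
  ultimately show ?thesis using X by blast
qed

lemma moore_penrose_equations:
  fixes T :: "'a::complex_hilbert_space \<Rightarrow> 'a"
  assumes T: "bounded_clinear T" and range: "closed (range T)" and c: "c > 0"
    and below: "\<forall>x\<in>orthogonal_complement (null_space T). c * norm x \<le> norm (T x)"
  shows "bounded_clinear (moore_penrose T) \<and> self_adjoint (T \<circ> moore_penrose T) \<and>
    self_adjoint (moore_penrose T \<circ> T) \<and> T \<circ> moore_penrose T \<circ> T = T \<and>
    moore_penrose T \<circ> T \<circ> moore_penrose T = moore_penrose T"
proof -
  have "\<exists>!X. bounded_clinear X \<and> self_adjoint (T \<circ> X) \<and> self_adjoint (X \<circ> T) \<and>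
    T \<circ> X \<circ> T = T \<and> X \<circ> T \<circ> X = X"
    by (rule ex_ex1I[OF moore_penrose_exists[OF assms]]) (elim conjE, rule moore_penrose_unique[OF T])
  from theI'[OF this] show ?thesis unfolding moore_penrose_def .
qed

section \<open>Operators with a left inverse modulo compact operators\<close>

text \<open>Unit vectors \<open>u\<^sub>n\<close> orthogonal to the null space with \<open>T u\<^sub>n \<longlonglongrightarrow> 0\<close> would satisfy
  \<open>u\<^sub>n + C u\<^sub>n \<longlonglongrightarrow> 0\<close>, so by compactness a subsequence would converge to a unit vector that is both in
  the null space and orthogonal to it.\<close>

lemma bounded_below_of_left_inverse_modulo_compact:
  fixes T W C :: "'a::complex_hilbert_space \<Rightarrow> 'a"
  assumes T: "bounded_clinear T" and W: "bounded_clinear W" and C: "compact_operator C"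
    and WT: "\<And>x. W (T x) = x + C x"
  shows "\<exists>c>0. \<forall>x\<in>orthogonal_complement (null_space T). c * norm x \<le> norm (T x)"
proof (rule ccontr)
  let ?H = "orthogonal_complement (null_space T)"
  assume no: "\<not> (\<exists>c>0. \<forall>x\<in>?H. c * norm x \<le> norm (T x))"
  have "\<exists>u\<in>?H. norm u = 1 \<and> norm (T u) < inverse (real (Suc n))" for n
  proof -
    have "inverse (real (Suc n)) > 0" by simp
    then obtain x where x: "x \<in> ?H" "norm (T x) < inverse (real (Suc n)) * norm x"
      using no not_le by blast
    then have x0: "norm x > 0" by (metis mult_zero_right norm_ge_zero not_less zero_less_norm_iff norm_zero)
    let ?u = "complex_of_real (1 / norm x) *\<^sub>C x"
    have "?u \<in> ?H" by (rule complex_vector.subspace_scale[OF subspace_orthogonal_complement x(1)])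
    moreover have "norm ?u = 1" using x0 by (simp add: norm_scaleC norm_divide)
    moreover have "norm (T ?u) = norm (T x) / norm x"
      by (simp add: bounded_clinear_scaleC[OF T] norm_scaleC norm_divide)
    ultimately show ?thesis using x(2) x0 by (intro bexI[of _ ?u]) (auto simp: divide_less_eq)
  qed
  then obtain u where u: "\<And>n. u n \<in> ?H" "\<And>n. norm (u n) = 1"
    "\<And>n. norm (T (u n)) < inverse (real (Suc n))" by metis
  have Tu: "(\<lambda>n. T (u n)) \<longlonglongrightarrow> 0"
    by (rule Lim_null_comparison[OF always_eventually LIMSEQ_inverse_real_of_nat])
      (intro allI less_imp_le u(3))
  obtain r l where r: "strict_mono r" and l: "(\<lambda>n. C (u (r n))) \<longlonglongrightarrow> l"
    by (rule compact_operator_subsequence[OF C, of u 1]) (simp add: u(2))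
  have Tur: "(\<lambda>n. T (u (r n))) \<longlonglongrightarrow> 0"
    using LIMSEQ_subseq_LIMSEQ[OF Tu r] by (simp add: o_def)
  have "(\<lambda>n. W (T (u (r n))) - C (u (r n))) \<longlonglongrightarrow> W 0 - l"
    by (intro tendsto_diff bounded_clinear_tendsto[OF W] Tur l)
  then have u_lim: "(\<lambda>n. u (r n)) \<longlonglongrightarrow> W 0 - l" by (simp add: WT)
  have "W 0 - l \<in> ?H" by (rule orthogonal_complement_limit[OF u(1) u_lim])
  moreover have "T (W 0 - l) = 0"
    by (rule LIMSEQ_unique[OF bounded_clinear_tendsto[OF T u_lim] Tur])
  ultimately have "cinner (W 0 - l) (W 0 - l) = 0"
    by (simp add: orthogonal_complement_def null_space_def)
  then have "norm (W 0 - l) = 0" by (simp add: cinner_self)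
  moreover have "norm (W 0 - l) = 1"
    using LIMSEQ_unique[OF tendsto_norm[OF u_lim], of 1] by (simp add: u(2))
  ultimately show False by simp
qed

text \<open>A convergent sequence in the range has preimages orthogonal to the null space, and these form a
  Cauchy sequence.\<close>

lemma closed_range_of_bounded_below:
  fixes T :: "'a::complex_hilbert_space \<Rightarrow> 'a"
  assumes T: "bounded_clinear T" and c: "c > 0"
    and below: "\<forall>x\<in>orthogonal_complement (null_space T). c * norm x \<le> norm (T x)"
  shows "closed (range T)"
  unfolding closed_sequential_limits
proof (intro allI impI, elim conjE)
  fix y l assume y: "\<forall>n. y n \<in> range T" and l: "y \<longlonglongrightarrow> l"
  let ?H = "orthogonal_complement (null_space T)"
  let ?P = "orthogonal_projection (null_space T)"
  note N = closed_null_space[OF T] subspace_null_space[OF T]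
  have "\<exists>u\<in>?H. T u = y n" for n
  proof -
    obtain x where "y n = T x" using y by blast
    moreover have "T (x - ?P x) = T x"
      using orthogonal_projection_in[OF N, of x] by (simp add: bounded_clinear_diff[OF T] null_space_def)
    ultimately show ?thesis using orthogonal_projection_diff[OF N, of x] by metis
  qed
  then obtain u where u: "\<And>n. u n \<in> ?H" "\<And>n. T (u n) = y n" by metis
  have "Cauchy u"
  proof (rule CauchyI)
    fix e :: real assume "e > 0"
    then obtain K where K: "\<And>m n. m \<ge> K \<Longrightarrow> n \<ge> K \<Longrightarrow> norm (y m - y n) < c * e"
      using CauchyD[OF LIMSEQ_imp_Cauchy[OF l], of "c * e"] c by auto
    have "norm (u m - u n) < e" if "m \<ge> K" "n \<ge> K" for m n
    proof -
      have "c * norm (u m - u n) \<le> norm (T (u m - u n))"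
        by (intro below[rule_format] complex_vector.subspace_diff[OF subspace_orthogonal_complement] u(1))
      also have "\<dots> < c * e" using K[OF that] by (simp add: bounded_clinear_diff[OF T] u(2))
      finally show ?thesis using c by simp
    qed
    then show "\<exists>K. \<forall>m\<ge>K. \<forall>n\<ge>K. norm (u m - u n) < e" by blast
  qed
  then obtain x where "u \<longlonglongrightarrow> x" using Cauchy_convergent convergent_def by blast
  from bounded_clinear_tendsto[OF T this] have "y \<longlonglongrightarrow> T x" by (simp add: u(2))
  then have "l = T x" using l LIMSEQ_unique by blast
  then show "l \<in> range T" by blast
qed

section \<open>The Moore--Penrose inverse of a perturbed partial isometry\<close>

theorem theorem3p1:
  fixes T V K :: "'a::complex_hilbert_space \<Rightarrow> 'a"
    and \<alpha> p :: real
  assumes infinite_dim: "\<not> finite_dimensional (UNIV :: 'a set)"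
    and separable: "\<exists>D :: 'a set. countable D \<and> closure D = UNIV"
    and T: "bounded_clinear T"
    and p: "1 \<le> p"
    and decomp: "T = (\<lambda>x. complex_of_real (sqrt \<alpha>) *\<^sub>C V x + K x)"
    and K: "K \<in> schatten_class p"
    and \<alpha>: "\<alpha> > 0"
    and V: "bounded_clinear V" "partial_isometry V"
    and null_V: "finite_dimensional (null_space V)"
  shows "closed (range T) \<and>
    (\<exists>L \<in> schatten_class p.
       moore_penrose T = (\<lambda>x. complex_of_real (1 / sqrt \<alpha>) *\<^sub>C cadjoint V x + L x)) \<and>
    (\<lambda>x. moore_penrose T x - complex_of_real (1 / sqrt \<alpha>) *\<^sub>C cadjoint V x) \<in> schatten_class p"
proof -
  have p0: "0 \<le> p" using p by simp
  let ?a = "complex_of_real (sqrt \<alpha>)" and ?b = "complex_of_real (1 / sqrt \<alpha>)"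
  have ba: "?b * ?a = 1" using \<alpha> by (simp flip: of_real_mult)
  have Kb: "bounded_clinear K"
    using K by (simp add: schatten_class_def compact_operator_imp_bounded_clinear)
  have V': "bounded_clinear (cadjoint V)" by (rule bounded_clinear_cadjoint[OF V(1)])
  define W where "W x = ?b *\<^sub>C cadjoint V x" for x
  have W: "bounded_clinear W"
    unfolding W_def by (rule bounded_clinear_compose[OF bounded_clinear_scaleC_ident V'])
  define C where "C x = W (K x) - orthogonal_projection (null_space V) x" for x
  have C: "C \<in> schatten_class p"
    unfolding C_def
    by (intro schatten_class_minus[OF p0] schatten_class_compose_left[OF p0 W K]
        orthogonal_projection_finite_dimensional[OF p0 null_V closed_null_space[OF V(1)]])
  then have Cc: "compact_operator C" by (simp add: schatten_class_def)
  have WT: "W (T x) = x + C x" for x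
  proof -
    have "W (T x) = ?b *\<^sub>C ?a *\<^sub>C cadjoint V (V x) + W (K x)"
      by (simp add: decomp W_def bounded_clinear_add[OF V'] bounded_clinear_scaleC[OF V'] scaleC_add_right)
    then show ?thesis
      by (simp only: scaleC_scaleC ba complex_vector.scale_one partial_isometry_cadjoint_self[OF V(2)] C_def
          add_diff_eq diff_add_eq)
  qed
  obtain c where c: "c > 0" "\<forall>x\<in>orthogonal_complement (null_space T). c * norm x \<le> norm (T x)"
    using bounded_below_of_left_inverse_modulo_compact[OF T W Cc WT] by blast
  have closed: "closed (range T)" by (rule closed_range_of_bounded_below[OF T c])
  define S where "S = moore_penrose T"
  have S: "bounded_clinear S" and TS_sym: "self_adjoint (T \<circ> S)" and TST: "T (S (T x)) = T x" for x
    using moore_penrose_equations[OF T closed c] by (auto simp: S_def fun_eq_iff)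
  have TS: "bounded_clinear (T \<circ> S)" using bounded_clinear_compose[OF T S] by (simp add: o_def)
  define z where "z y = y - T (S y)" for y
  have z: "bounded_clinear z"
    unfolding z_def by (intro bounded_clinear_minus bounded_clinear_ident bounded_clinear_compose[OF T S])
  \<comment> \<open>The vector \<open>z y\<close> is orthogonal to the range of \<open>T\<close>, that is, \<open>T\<^sup>* z y = 0\<close>.\<close>
  have V_z: "?a *\<^sub>C cadjoint V (z y) = - cadjoint K (z y)" for y
  proof -
    have "cinner (?a *\<^sub>C cadjoint V (z y) + cadjoint K (z y)) x = 0" for x
    proof -
      have "cinner (?a *\<^sub>C cadjoint V (z y) + cadjoint K (z y)) x = cinner (z y) (T x)"
        by (simp add: decomp cinner_add_left cinner_add_right cinner_scaleC_left cinner_scaleC_right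
            cinner_cadjoint_left[OF V(1)] cinner_cadjoint_left[OF Kb])
      also have "\<dots> = cinner y (T x) - cinner y (T (S (T x)))"
        using self_adjoint_cinner[OF TS TS_sym, of y "T x"] by (simp add: z_def cinner_diff_left)
      finally show ?thesis by (simp add: TST)
    qed
    then have "?a *\<^sub>C cadjoint V (z y) + cadjoint K (z y) = 0"
      by (intro cinner_eq_all_imp_eq) simp
    then show ?thesis by (simp add: eq_neg_iff_add_eq_0)
  qed
  have W_z: "W (z y) = - ((?b * ?b) *\<^sub>C cadjoint K (z y))" for y
  proof -
    have "W (z y) = (?b * ?b) *\<^sub>C ?a *\<^sub>C cadjoint V (z y)"
      by (simp only: W_def scaleC_scaleC mult.assoc ba mult_1_right)
    then show ?thesis by (simp only: V_z complex_vector.scale_minus_right)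
  qed
  define L where "L y = (?b * ?b) *\<^sub>C cadjoint K (z y) - C (S y)" for y
  have L: "L \<in> schatten_class p"
    unfolding L_def
    by (intro schatten_class_minus[OF p0] schatten_class_scaleC[OF p0]
        schatten_class_compose_right[OF p0 schatten_class_cadjoint[OF p0 K] z]
        schatten_class_compose_right[OF p0 C S])
  have S_eq: "S y = W y + L y" for y
  proof -
    have "S y + C (S y) = W y - W (z y)"
      by (simp add: WT[symmetric] z_def bounded_clinear_diff[OF W])
    then show ?thesis by (simp add: W_z L_def algebra_simps)
  qed
  have "S = (\<lambda>x. ?b *\<^sub>C cadjoint V x + L x)" by (intro ext) (simp only: S_eq W_def)
  moreover have "(\<lambda>x. S x - ?b *\<^sub>C cadjoint V x) = L" by (intro ext) (simp add: S_eq W_def)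
  ultimately show ?thesis using closed L unfolding S_def by metis
qed

end
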